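(* Let $\lambda>0$, $\mu_0>0$, $a>0$, $\gamma>1$, $G=\mu_0/\lambda$, $p(\rho)=a\rho^\gamma$, and consider on $\mathbb{R}^3$ the Cauchy problem for the system $$ \begin{cases} \rho_t + \nabla \cdot (\rho \mathbf{u}) = 0, \\ \rho \mathbf{u}_t + \rho \mathbf{u} \cdot \nabla \mathbf{u} + \nabla p(\rho) = \nabla \cdot \big(\rho G(\mathbf{F} \mathbf{A} \mathbf{F}^T - \mathbf{I}_3)\big), \\ \lambda (\mathbf{A}_t + \mathbf{u} \cdot \nabla \mathbf{A}) + \mathbf{A} = \mathbf{F}^{-1} \mathbf{F}^{-T}, \\ \mathbf{F}_t + \mathbf{u} \cdot \nabla \mathbf{F} = (\nabla \mathbf{u}) \mathbf{F}, \end{cases} $$ with smooth initial data $(\rho,\mathbf u,\mathbf A,\mathbf F)(0,\cdot)=(\rho_0,\mathbf u_0,\mathbf A_0,\mathbf F_0)$. Then there exist initial data $(\rho_0,\mathbf u_0,\mathbf A_0,\mathbf F_0)$ satisfying 1. $(\rho_0-1,\mathbf u_0,\mathbf A_0-\mathbf I_3,\mathbf F_0-\mathbf I_3)$ is compactly supported in $B_R=\{\mathbf x\in\mathbb R^3:|\mathbf x|\le R\}$ for some $R>0$; 2. $\int_{\mathbb R^3}(\rho_0-1)\,d\mathbf x\ge 0$; 3. $\mathrm{tr}(\mathbf T_0)\ge 0$, where $\mathbf T_0=\rho_0G(\mathbf F_0\mathbf A_0\mathbf F_0^T-\mathbf I_3)$; 4. with $W(0)=\int_{\mathbb R^3}\mathbf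 x\cdot\rho_0(\mathbf x)\mathbf u_0(\mathbf x)\,d\mathbf x$, $$ W(0)\ \ge\ \lambda\left(H_0+\max\rho_0\,\|\mathbf u_0\|_{L^2}^2\right)+\frac{16R^4\sigma\pi\max\rho_0}{3}, $$ where $\sigma$ is the finite-propagation-speed constant described in the context and $$ H_0=\int_{\mathbb R^3}\left(\frac{2a}{\gamma-1}\big(\rho_0^\gamma-1-\gamma(\rho_0-1)\big)+\frac{2\mu_0}{\lambda}\big(\rho_0\ln\rho_0-\rho_0+1\big)+\mathrm{tr}(\mathbf T_0)\right)d\mathbf x , $$ such that, for any $C^1$ solution $(\rho,\mathbf u,\mathbf A,\mathbf F)$ of the Cauchy problem with these data, the life span $T$ of the $C^1$ solution is finite.
   Context: The unknowns are functions of time $t\ge 0$ and $\mathbf x\in\mathbb R^3$: density $\rho>0$, velocity $\mathbf u\in\mathbb R^3$, symmetric positive definite $3\times3$ matrix $\mathbf A$, and invertible $3\times 3$ deformation gradient $\mathbf F$. $\mathbf I_3$ is the $3\times3$ identity matrix, $(\nabla\mathbf u)_{ij}=\partial_j u_i$, the divergence of a symmetric matrix field is taken row-wise, and $\mathbf F^{-T}=(\mathbf F^{-1})^T$. The background density is normalized to $1$. The constant $\sigma$ is the one provided by the following finite propagation speed property of this hyperbolic system: if the initial data satisfy conditions 1, 2, 3 of the claim and $(\rho,\mathbf u,\mathbf A,\mathbf F)$ is a $C^1$ solution of the system on $[0,T]$, then there exists a constant $\sigma$ such that $(\rho-1,\mathbf u,\mathbf A-\mathbf I_3,\mathbf F-\mathbf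 I_3)(\cdot,t)=(0,0,0,0)$ on $\{\mathbf x\in\mathbb R^3:|\mathbf x|>R+\sigma t\}$ for $0\le t\le T$. *)

theory Defs
  imports "HOL-Analysis.Analysis"
begin

section \<open>Regularity\<close>

text \<open>Continuously differentiable on a set \<open>S\<close>, with derivatives taken within \<open>S\<close>;
  on \<open>[0,T) \<times> \<real>\<^sup>3\<close> the time derivative at \<open>t = 0\<close> is thus one-sided.\<close>

definition C1_on :: "'a::real_normed_vector set \<Rightarrow> ('a \<Rightarrow> 'b::real_normed_vector) \<Rightarrow> bool" where
  "C1_on S f \<longleftrightarrow> (\<exists>D :: 'a \<Rightarrow> ('a \<Rightarrow>\<^sub>L 'b).
     (\<forall>z\<in>S. (f has_derivative blinfun_apply (D z)) (at z within S)) \<and> continuous_on S D)"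

text \<open>\<open>k\<close> times differentiable, with all \<open>k\<close>-th directional derivatives continuous (class \<open>C\<^sup>k\<close>
  on finite-dimensional spaces).\<close>

primrec Ck :: "nat \<Rightarrow> ('a::real_normed_vector \<Rightarrow> 'b::real_normed_vector) \<Rightarrow> bool" where
  "Ck 0 f \<longleftrightarrow> continuous_on UNIV f"
| "Ck (Suc k) f \<longleftrightarrow> (\<forall>x. f differentiable (at x)) \<and>
     (\<forall>v. Ck k (\<lambda>x. frechet_derivative f (at x) v))"

definition smooth :: "('a::real_normed_vector \<Rightarrow> 'b::real_normed_vector) \<Rightarrow> bool" where
  "smooth f \<longleftrightarrow> (\<forall>k. Ck k f)"

section \<open>Differential operators in space\<close>

definition partial :: "3 \<Rightarrow> (real^3 \<Rightarrow> 'b::real_normed_vector) \<Rightarrow> real^3 \<Rightarrow> 'b" where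
  "partial j f x = frechet_derivative f (at x) (axis j 1)"

definition grad :: "(real^3 \<Rightarrow> real) \<Rightarrow> real^3 \<Rightarrow> real^3" where
  "grad f x = (\<chi> j. partial j f x)"

definition div_vec :: "(real^3 \<Rightarrow> real^3) \<Rightarrow> real^3 \<Rightarrow> real" where
  "div_vec v x = (\<Sum>j\<in>UNIV. partial j (\<lambda>y. v y $ j) x)"

definition div_mat :: "(real^3 \<Rightarrow> real^3^3) \<Rightarrow> real^3 \<Rightarrow> real^3" where
  "div_mat M x = (\<chi> i. \<Sum>j\<in>UNIV. partial j (\<lambda>y. M y $ i $ j) x)"

definition grad_vec :: "(real^3 \<Rightarrow> real^3) \<Rightarrow> real^3 \<Rightarrow> real^3^3" where
  "grad_vec v x = (\<chi> i j. partial j (\<lambda>y. v y $ i) x)"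

text \<open>\<open>advect v f = v \<cdot> \<nabla>f\<close>, for scalar, vector or matrix fields \<open>f\<close>.\<close>

definition advect :: "(real^3 \<Rightarrow> real^3) \<Rightarrow> (real^3 \<Rightarrow> 'b::real_normed_vector) \<Rightarrow> real^3 \<Rightarrow> 'b" where
  "advect v f x = (\<Sum>j\<in>UNIV. (v x $ j) *\<^sub>R partial j f x)"

section \<open>The system\<close>

definition sym_pos_def :: "real^3^3 \<Rightarrow> bool" where
  "sym_pos_def M \<longleftrightarrow> transpose M = M \<and> (\<forall>x. x \<noteq> 0 \<longrightarrow> 0 < x \<bullet> (M *v x))"

definition pressure :: "real \<Rightarrow> real \<Rightarrow> real \<Rightarrow> real" where
  "pressure a \<gamma> r = a * r powr \<gamma>"

definition stress :: "real \<Rightarrow> real \<Rightarrow> real \<Rightarrow> real^3^3 \<Rightarrow> real^3^3 \<Rightarrow> real^3^3" where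
  "stress lam \<mu>\<^sub>0 r A F =
     (let G = \<mu>\<^sub>0 / lam in (r * G) *\<^sub>R (F ** A ** transpose F - mat 1))"

text \<open>\<open>(\<rho>,u,A,F)\<close> is a \<open>C\<^sup>1\<close> solution for times in the interval \<open>I\<close> (used with
  \<open>I = [0,T]\<close> and \<open>I = [0,T)\<close>, \<open>T > 0\<close>); values at times outside \<open>I\<close> are irrelevant.\<close>

definition C1_solution ::
  "real \<Rightarrow> real \<Rightarrow> real \<Rightarrow> real \<Rightarrow> real set \<Rightarrow> (real \<Rightarrow> real^3 \<Rightarrow> real) \<Rightarrow> (real \<Rightarrow> real^3 \<Rightarrow> real^3) \<Rightarrow>
   (real \<Rightarrow> real^3 \<Rightarrow> real^3^3) \<Rightarrow> (real \<Rightarrow> real^3 \<Rightarrow> real^3^3) \<Rightarrow> bool" where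
  "C1_solution lam \<mu>\<^sub>0 a \<gamma> I \<rho> u A F \<longleftrightarrow>
     C1_on (I \<times> UNIV) (\<lambda>(t, x). \<rho> t x) \<and>
     C1_on (I \<times> UNIV) (\<lambda>(t, x). u t x) \<and>
     C1_on (I \<times> UNIV) (\<lambda>(t, x). A t x) \<and>
     C1_on (I \<times> UNIV) (\<lambda>(t, x). F t x) \<and>
     (\<forall>t\<in>I. \<forall>x. 0 < \<rho> t x \<and> sym_pos_def (A t x) \<and> invertible (F t x)) \<and>
     (\<forall>t\<in>I. \<forall>x.
        vector_derivative (\<lambda>s. \<rho> s x) (at t within I)
          + div_vec (\<lambda>y. \<rho> t y *\<^sub>R u t y) x = 0 \<and>
        \<rho> t x *\<^sub>R vector_derivative (\<lambda>s. u s x) (at t within I)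
          + \<rho> t x *\<^sub>R advect (u t) (u t) x
          + grad (\<lambda>y. pressure a \<gamma> (\<rho> t y)) x
          = div_mat (\<lambda>y. stress lam \<mu>\<^sub>0 (\<rho> t y) (A t y) (F t y)) x \<and>
        lam *\<^sub>R (vector_derivative (\<lambda>s. A s x) (at t within I) + advect (u t) (A t) x) + A t x
          = matrix_inv (F t x) ** transpose (matrix_inv (F t x)) \<and>
        vector_derivative (\<lambda>s. F s x) (at t within I) + advect (u t) (F t) x
          = grad_vec (u t) x ** F t x)"

section \<open>Initial data\<close>

definition smooth_data ::
  "(real^3 \<Rightarrow> real) \<Rightarrow> (real^3 \<Rightarrow> real^3) \<Rightarrow> (real^3 \<Rightarrow> real^3^3) \<Rightarrow> (real^3 \<Rightarrow> real^3^3) \<Rightarrow> bool" where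
  "smooth_data \<rho>\<^sub>0 u\<^sub>0 A\<^sub>0 F\<^sub>0 \<longleftrightarrow>
     smooth \<rho>\<^sub>0 \<and> smooth u\<^sub>0 \<and> smooth A\<^sub>0 \<and> smooth F\<^sub>0 \<and>
     (\<forall>x. 0 < \<rho>\<^sub>0 x \<and> sym_pos_def (A\<^sub>0 x) \<and> invertible (F\<^sub>0 x))"

definition background_outside ::
  "real \<Rightarrow> (real^3 \<Rightarrow> real) \<Rightarrow> (real^3 \<Rightarrow> real^3) \<Rightarrow> (real^3 \<Rightarrow> real^3^3) \<Rightarrow> (real^3 \<Rightarrow> real^3^3) \<Rightarrow> bool" where
  "background_outside R \<rho> u A F \<longleftrightarrow>
     (\<forall>x. R < norm x \<longrightarrow> \<rho> x - 1 = 0 \<and> u x = 0 \<and> A x - mat 1 = 0 \<and> F x - mat 1 = 0)"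

definition admissible_data ::
  "real \<Rightarrow> real \<Rightarrow> real \<Rightarrow> (real^3 \<Rightarrow> real) \<Rightarrow> (real^3 \<Rightarrow> real^3) \<Rightarrow> (real^3 \<Rightarrow> real^3^3) \<Rightarrow>
   (real^3 \<Rightarrow> real^3^3) \<Rightarrow> bool" where
  "admissible_data lam \<mu>\<^sub>0 R \<rho>\<^sub>0 u\<^sub>0 A\<^sub>0 F\<^sub>0 \<longleftrightarrow>
     smooth_data \<rho>\<^sub>0 u\<^sub>0 A\<^sub>0 F\<^sub>0 \<and>
     0 < R \<and> background_outside R \<rho>\<^sub>0 u\<^sub>0 A\<^sub>0 F\<^sub>0 \<and>
     0 \<le> (\<integral>x. (\<rho>\<^sub>0 x - 1) \<partial>lborel) \<and>
     (\<forall>x. 0 \<le> trace (stress lam \<mu>\<^sub>0 (\<rho>\<^sub>0 x) (A\<^sub>0 x) (F\<^sub>0 x)))"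

definition initial_condition ::
  "(real \<Rightarrow> real^3 \<Rightarrow> real) \<Rightarrow> (real \<Rightarrow> real^3 \<Rightarrow> real^3) \<Rightarrow> (real \<Rightarrow> real^3 \<Rightarrow> real^3^3) \<Rightarrow>
   (real \<Rightarrow> real^3 \<Rightarrow> real^3^3) \<Rightarrow>
   (real^3 \<Rightarrow> real) \<Rightarrow> (real^3 \<Rightarrow> real^3) \<Rightarrow> (real^3 \<Rightarrow> real^3^3) \<Rightarrow> (real^3 \<Rightarrow> real^3^3) \<Rightarrow> bool" where
  "initial_condition \<rho> u A F \<rho>\<^sub>0 u\<^sub>0 A\<^sub>0 F\<^sub>0 \<longleftrightarrow> \<rho> 0 = \<rho>\<^sub>0 \<and> u 0 = u\<^sub>0 \<and> A 0 = A\<^sub>0 \<and> F 0 = F\<^sub>0"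

section \<open>Finite propagation speed\<close>

text \<open>\<open>\<sigma>\<close> is a constant of the system, i.e. it may depend on the parameters
  \<open>lam\<close>, \<open>\<mu>\<^sub>0\<close>, \<open>a\<close>, \<open>\<gamma>\<close> but not on the data or the solution.\<close>

definition propagation_speed :: "real \<Rightarrow> real \<Rightarrow> real \<Rightarrow> real \<Rightarrow> real \<Rightarrow> bool" where
  "propagation_speed lam \<mu>\<^sub>0 a \<gamma> \<sigma> \<longleftrightarrow> 0 < \<sigma> \<and>
     (\<forall>R \<rho>\<^sub>0 u\<^sub>0 A\<^sub>0 F\<^sub>0 T \<rho> u A F.
        admissible_data lam \<mu>\<^sub>0 R \<rho>\<^sub>0 u\<^sub>0 A\<^sub>0 F\<^sub>0 \<longrightarrow>
        0 < T \<longrightarrow> C1_solution lam \<mu>\<^sub>0 a \<gamma> {0..T} \<rho> u A F \<longrightarrow>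
        initial_condition \<rho> u A F \<rho>\<^sub>0 u\<^sub>0 A\<^sub>0 F\<^sub>0 \<longrightarrow>
        (\<forall>t\<in>{0..T}. background_outside (R + \<sigma> * t) (\<rho> t) (u t) (A t) (F t)))"

section \<open>Functionals of the initial data\<close>

definition radial_momentum :: "(real^3 \<Rightarrow> real) \<Rightarrow> (real^3 \<Rightarrow> real^3) \<Rightarrow> real" where
  "radial_momentum \<rho> u = (\<integral>x. x \<bullet> (\<rho> x *\<^sub>R u x) \<partial>lborel)"

definition L2_norm :: "(real^3 \<Rightarrow> real^3) \<Rightarrow> real" where
  "L2_norm u = sqrt (\<integral>x. (norm (u x))\<^sup>2 \<partial>lborel)"

definition H_functional ::
  "real \<Rightarrow> real \<Rightarrow> real \<Rightarrow> real \<Rightarrow> (real^3 \<Rightarrow> real) \<Rightarrow> (real^3 \<Rightarrow> real^3^3) \<Rightarrow> (real^3 \<Rightarrow> real^3^3) \<Rightarrow> real" where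
  "H_functional lam \<mu>\<^sub>0 a \<gamma> \<rho> A F =
     (\<integral>x. 2 * a / (\<gamma> - 1) * (\<rho> x powr \<gamma> - 1 - \<gamma> * (\<rho> x - 1))
          + 2 * \<mu>\<^sub>0 / lam * (\<rho> x * ln (\<rho> x) - \<rho> x + 1)
          + trace (stress lam \<mu>\<^sub>0 (\<rho> x) (A x) (F x)) \<partial>lborel)"

text \<open>The supremum over \<open>\<real>\<^sup>3\<close> is a maximum for the data considered, since \<open>\<rho>\<^sub>0\<close> is continuous and
  equal to 1 outside a ball.\<close>

definition max_density :: "(real^3 \<Rightarrow> real) \<Rightarrow> real" where
  "max_density \<rho> = (SUP x. \<rho> x)"

end

theory Submission
  imports Defs
begin

text \<open>The data are \<open>\<rho>\<^sub>0 = 1\<close>, \<open>A\<^sub>0 = F\<^sub>0 = I\<close> and a radial bump \<open>u\<^sub>0\<close> supported in a large ball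
  of radius \<open>R\<close>, so that \<open>W(0)\<close> is of order \<open>\<sigma> R\<^sup>4\<close> with a large constant while \<open>\<parallel>u\<^sub>0\<parallel>\<^sup>2\<close> is of order \<open>R\<^sup>3\<close>.
  Write \<open>G = \<mu>\<^sub>0 / \<lambda>\<close>, \<open>B = F A F\<^sup>T\<close>, \<open>T = \<rho> G (B - I)\<close>, \<open>S = T - (p - a) I\<close>.  The trace of the
  stress in \<open>W'\<close> has no sign, but it is also \<open>-\<lambda>\<close> times the rate of change of the energy. Hence for
  \<open>f = x \<cdot> u - \<lambda> (|u|\<^sup>2 + G tr B + P(\<rho>))\<close>, with a suitable \<open>P\<close>,
  the quantity \<open>\<rho> (f\<^sub>t + u \<cdot> \<nabla>f) - \<rho> |u|\<^sup>2 - 3 (p - a)\<close> is the divergence of \<open>(x - 2 \<lambda> u) \<cdot> S\<close>.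
  As \<open>\<integral>(\<rho> - 1) = 0\<close>, convexity gives \<open>\<integral>(p - a) \<ge> 0\<close>, so \<open>z = \<integral>\<rho> f + const\<close> satisfies
  \<open>z' \<ge> \<integral>\<rho> |u|\<^sup>2\<close>. Dropping \<open>|u|\<^sup>2\<close> and \<open>tr B \<ge> 0\<close> and using convexity of \<open>\<rho> P(\<rho>)\<close>
  gives \<open>z \<le> W\<close>, and Cauchy-Schwarz yields \<open>z\<^sup>2 \<le> W\<^sup>2 \<le> K z'\<close> with \<open>K\<close> of order \<open>R\<^sup>5\<close> as long as
  the perturbation stays in the ball of radius \<open>2 R\<close>, i.e. up to time \<open>R / \<sigma>\<close>. With the chosen \<open>W(0)\<close>
  this Riccati inequality breaks down before that time.\<close>

section \<open>Space-time derivatives\<close>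

definition C1_derivs :: "real set \<Rightarrow> (real \<Rightarrow> real^'n \<Rightarrow> 'b::real_normed_vector) \<Rightarrow>
    (real \<Rightarrow> real^'n \<Rightarrow> 'b) \<Rightarrow> ('n \<Rightarrow> real \<Rightarrow> real^'n \<Rightarrow> 'b) \<Rightarrow> bool" where
  "C1_derivs J f ft fx \<longleftrightarrow>
     (\<forall>t\<in>J. \<forall>x. ((\<lambda>z. f (fst z) (snd z)) has_derivative
        (\<lambda>k. fst k *\<^sub>R ft t x + (\<Sum>j\<in>UNIV. snd k $ j *\<^sub>R fx j t x))) (at (t, x) within J \<times> UNIV)) \<and>
     continuous_on (J \<times> UNIV) (\<lambda>z. ft (fst z) (snd z)) \<and>
     (\<forall>j. continuous_on (J \<times> UNIV) (\<lambda>z. fx j (fst z) (snd z)))"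

lemma C1_derivsD:
  assumes "C1_derivs J f ft fx"
  shows "t \<in> J \<Longrightarrow> ((\<lambda>z. f (fst z) (snd z)) has_derivative
        (\<lambda>k. fst k *\<^sub>R ft t x + (\<Sum>j\<in>UNIV. snd k $ j *\<^sub>R fx j t x))) (at (t, x) within J \<times> UNIV)"
    and "continuous_on (J \<times> UNIV) (\<lambda>z. ft (fst z) (snd z))"
    and "continuous_on (J \<times> UNIV) (\<lambda>z. fx j (fst z) (snd z))"
  using assms by (auto simp: C1_derivs_def)

lemma C1_derivs_continuous:
  assumes "C1_derivs J f ft fx"
  shows "continuous_on (J \<times> UNIV) (\<lambda>z. f (fst z) (snd z))"
proof (rule has_derivative_continuous_on)
  fix z :: "real \<times> (real^'a)" assume "z \<in> J \<times> UNIV"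
  then show "((\<lambda>z. f (fst z) (snd z)) has_derivative
        (\<lambda>k. fst k *\<^sub>R ft (fst z) (snd z) + (\<Sum>j\<in>UNIV. snd k $ j *\<^sub>R fx j (fst z) (snd z)))) (at z within J \<times> UNIV)"
    using C1_derivsD(1)[OF assms, of "fst z" "snd z"] by auto
qed

lemma continuous_on_slice:
  assumes "continuous_on (J \<times> UNIV) (\<lambda>z. f (fst z) (snd z))" and "t \<in> J"
  shows "continuous_on S (f t)"
proof -
  have "continuous_on S (\<lambda>x. f (fst (t, x)) (snd (t, x)))"
    by (rule continuous_on_compose2[OF assms(1)]) (use assms(2) in \<open>auto intro!: continuous_intros\<close>)
  then show ?thesis by simp
qed

lemma C1_derivs_slice:
  assumes "C1_derivs J f ft fx" and "t \<in> J"
  shows "continuous_on S (f t)"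
  by (rule continuous_on_slice[of J f, OF C1_derivs_continuous[OF assms(1)] assms(2)])

lemma C1_derivs_space:
  assumes "C1_derivs J f ft fx" and "t \<in> J"
  shows "(f t has_derivative (\<lambda>h. \<Sum>j\<in>UNIV. h $ j *\<^sub>R fx j t x)) (at x)"
proof -
  have "((\<lambda>z. f (fst z) (snd z)) \<circ> (\<lambda>y. (t, y)) has_derivative
     (\<lambda>k. fst k *\<^sub>R ft t x + (\<Sum>j\<in>UNIV. snd k $ j *\<^sub>R fx j t x)) \<circ> (\<lambda>h. (0, h))) (at x within UNIV)"
  proof (rule diff_chain_within)
    show "((\<lambda>y. (t, y)) has_derivative (\<lambda>h. (0, h))) (at x within UNIV)"
      by (auto intro!: derivative_eq_intros)
    show "((\<lambda>z. f (fst z) (snd z)) has_derivative (\<lambda>k. fst k *\<^sub>R ft t x + (\<Sum>j\<in>UNIV. snd k $ j *\<^sub>R fx j t x)))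
           (at (t, x) within range (Pair t))"
      by (rule has_derivative_subset[OF C1_derivsD(1)[OF assms]]) (use assms(2) in auto)
  qed
  then show ?thesis by (simp add: o_def)
qed

lemma C1_derivs_time:
  assumes "C1_derivs J f ft fx" and "t \<in> J"
  shows "((\<lambda>s. f s x) has_vector_derivative ft t x) (at t within J)"
proof -
  have "((\<lambda>z. f (fst z) (snd z)) \<circ> (\<lambda>s. (s, x)) has_derivative
     (\<lambda>k. fst k *\<^sub>R ft t x + (\<Sum>j\<in>UNIV. snd k $ j *\<^sub>R fx j t x)) \<circ> (\<lambda>s. (s, 0))) (at t within J)"
  proof (rule diff_chain_within)
    show "((\<lambda>s. (s, x)) has_derivative (\<lambda>s. (s, 0))) (at t within J)"
      by (auto intro!: derivative_eq_intros)
    show "((\<lambda>z. f (fst z) (snd z)) has_derivative (\<lambda>k. fst k *\<^sub>R ft t x + (\<Sum>j\<in>UNIV. snd k $ j *\<^sub>R fx j t x)))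
           (at (t, x) within (\<lambda>s. (s, x)) ` J)"
      by (rule has_derivative_subset[OF C1_derivsD(1)[OF assms]]) auto
  qed
  then show ?thesis by (simp add: o_def has_vector_derivative_def)
qed

lemma sum_axis_scaleR:
  fixes f :: "'n::finite \<Rightarrow> 'b::real_vector"
  shows "(\<Sum>i\<in>UNIV. axis j (1::real) $ i *\<^sub>R f i) = f j"
proof -
  have "(\<Sum>i\<in>UNIV. axis j (1::real) $ i *\<^sub>R f i) = (\<Sum>i\<in>UNIV. if i = j then f i else 0)"
    by (rule sum.cong) (auto simp: axis_def)
  then show ?thesis by simp
qed

lemma C1_derivs_partial:
  assumes "C1_derivs J f ft fx" and "t \<in> J"
  shows "partial j (f t) x = fx j t x"
  unfolding partial_def frechet_derivative_at[OF C1_derivs_space[OF assms], symmetric]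
  by (simp add: sum_axis_scaleR)

lemma C1_derivs_exists:
  fixes f :: "real \<Rightarrow> real^'n \<Rightarrow> 'b::real_normed_vector"
  assumes "C1_on (J \<times> UNIV) (\<lambda>(t, x). f t x)"
  obtains ft fx where "C1_derivs J f ft fx"
proof -
  obtain D :: "real \<times> (real^'n) \<Rightarrow> (real \<times> (real^'n)) \<Rightarrow>\<^sub>L 'b" where
    D: "\<And>z. z \<in> J \<times> UNIV \<Longrightarrow> ((\<lambda>(t, x). f t x) has_derivative blinfun_apply (D z)) (at z within J \<times> UNIV)"
    and cD: "continuous_on (J \<times> UNIV) D"
    using assms by (auto simp: C1_on_def)
  define ft where "ft t x = D (t, x) (1, 0)" for t x
  define fx where "fx j t x = D (t, x) (0, axis j 1)" for j t x
  have eq: "blinfun_apply (D (t, x)) = (\<lambda>k. fst k *\<^sub>R ft t x + (\<Sum>j\<in>UNIV. snd k $ j *\<^sub>R fx j t x))" for t x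
  proof
    fix k :: "real \<times> (real^'n)"
    interpret bounded_linear "blinfun_apply (D (t, x))" by (rule blinfun.bounded_linear_right)
    have "snd k = (\<Sum>j\<in>UNIV. snd k $ j *\<^sub>R axis j 1)"
      using basis_expansion[of "snd k"] by (simp add: scalar_mult_eq_scaleR)
    then have "k = fst k *\<^sub>R (1, 0) + (\<Sum>j\<in>UNIV. snd k $ j *\<^sub>R (0, axis j 1))"
      by (simp add: prod_eq_iff fst_sum snd_sum)
    then have "D (t, x) k = D (t, x) (fst k *\<^sub>R (1, 0) + (\<Sum>j\<in>UNIV. snd k $ j *\<^sub>R (0, axis j 1)))"
      by simp
    then show "D (t, x) k = fst k *\<^sub>R ft t x + (\<Sum>j\<in>UNIV. snd k $ j *\<^sub>R fx j t x)"
      by (simp only: add scaleR sum ft_def fx_def)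
  qed
  have "C1_derivs J f ft fx"
    unfolding C1_derivs_def
  proof (intro conjI ballI allI)
    fix t x assume "t \<in> J"
    then show "((\<lambda>z. f (fst z) (snd z)) has_derivative
        (\<lambda>k. fst k *\<^sub>R ft t x + (\<Sum>j\<in>UNIV. snd k $ j *\<^sub>R fx j t x))) (at (t, x) within J \<times> UNIV)"
      using D[of "(t, x)"] by (simp add: eq case_prod_beta')
  next
    show "continuous_on (J \<times> UNIV) (\<lambda>z. ft (fst z) (snd z))"
      unfolding ft_def using cD by (auto intro!: continuous_intros)
  next
    fix j show "continuous_on (J \<times> UNIV) (\<lambda>z. fx j (fst z) (snd z))"
      unfolding fx_def using cD by (auto intro!: continuous_intros)
  qed
  then show thesis by (rule that)
qed

lemma C1_derivs_const: "C1_derivs J (\<lambda>t x. c) (\<lambda>t x. 0) (\<lambda>j t x. 0)"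
  by (auto simp: C1_derivs_def)

lemma C1_derivs_position:
  "C1_derivs J (\<lambda>t x::real^'n. x) (\<lambda>t x. 0) (\<lambda>j t x. axis j 1)"
proof -
  have "(\<Sum>j\<in>UNIV. snd k $ j *\<^sub>R axis j 1) = snd k" for k :: "real \<times> (real^'n)"
    using basis_expansion[of "snd k"] by (simp add: scalar_mult_eq_scaleR)
  then show ?thesis
    by (auto simp: C1_derivs_def fun_eq_iff intro!: derivative_eq_intros)
qed

lemma C1_derivs_add:
  assumes "C1_derivs J f ft fx" and "C1_derivs J g gt gx"
  shows "C1_derivs J (\<lambda>t x. f t x + g t x) (\<lambda>t x. ft t x + gt t x) (\<lambda>j t x. fx j t x + gx j t x)"
  unfolding C1_derivs_def
proof (intro conjI ballI allI continuous_on_add C1_derivsD[OF assms(1)] C1_derivsD[OF assms(2)])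
  fix t x assume t: "t \<in> J"
  show "((\<lambda>z. f (fst z) (snd z) + g (fst z) (snd z)) has_derivative
    (\<lambda>k. fst k *\<^sub>R (ft t x + gt t x) + (\<Sum>j\<in>UNIV. snd k $ j *\<^sub>R (fx j t x + gx j t x)))) (at (t, x) within J \<times> UNIV)"
    by (rule has_derivative_eq_rhs[OF has_derivative_add[OF C1_derivsD(1)[OF assms(1) t] C1_derivsD(1)[OF assms(2) t]]])
      (simp add: sum.distrib algebra_simps)
qed

lemma C1_derivs_linear:
  assumes "bounded_linear L" and "C1_derivs J f ft fx"
  shows "C1_derivs J (\<lambda>t x. L (f t x)) (\<lambda>t x. L (ft t x)) (\<lambda>j t x. L (fx j t x))"
  unfolding C1_derivs_def
proof (intro conjI ballI allI bounded_linear.continuous_on[OF assms(1)] C1_derivsD[OF assms(2)])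
  interpret bounded_linear L by fact
  fix t x assume t: "t \<in> J"
  show "((\<lambda>z. L (f (fst z) (snd z))) has_derivative
    (\<lambda>k. fst k *\<^sub>R L (ft t x) + (\<Sum>j\<in>UNIV. snd k $ j *\<^sub>R L (fx j t x)))) (at (t, x) within J \<times> UNIV)"
    by (rule has_derivative_eq_rhs[OF bounded_linear.has_derivative[OF assms(1) C1_derivsD(1)[OF assms(2) t]]])
      (simp add: add scaleR sum)
qed

lemma C1_derivs_bilinear:
  assumes "bounded_bilinear B" and "C1_derivs J f ft fx" and "C1_derivs J g gt gx"
  shows "C1_derivs J (\<lambda>t x. B (f t x) (g t x)) (\<lambda>t x. B (f t x) (gt t x) + B (ft t x) (g t x))
     (\<lambda>j t x. B (f t x) (gx j t x) + B (fx j t x) (g t x))"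
  unfolding C1_derivs_def
proof (intro conjI ballI allI bounded_bilinear.continuous_on[OF assms(1)] continuous_on_add
    C1_derivsD[OF assms(2)] C1_derivsD[OF assms(3)] C1_derivs_continuous[OF assms(2)] C1_derivs_continuous[OF assms(3)])
  interpret bounded_bilinear B by fact
  fix t x assume t: "t \<in> J"
  show "((\<lambda>z. B (f (fst z) (snd z)) (g (fst z) (snd z))) has_derivative
    (\<lambda>k. fst k *\<^sub>R (B (f t x) (gt t x) + B (ft t x) (g t x)) +
       (\<Sum>j\<in>UNIV. snd k $ j *\<^sub>R (B (f t x) (gx j t x) + B (fx j t x) (g t x))))) (at (t, x) within J \<times> UNIV)"
    by (rule has_derivative_eq_rhs[OF bounded_bilinear.FDERIV[OF assms(1) C1_derivsD(1)[OF assms(2) t] C1_derivsD(1)[OF assms(3) t]]])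
      (simp add: add_right add_left scaleR_right scaleR_left sum_left sum_right sum.distrib fun_eq_iff algebra_simps)
qed

lemma C1_derivs_compose:
  fixes f :: "real \<Rightarrow> real^'n \<Rightarrow> real"
  assumes f: "C1_derivs J f ft fx" and pos: "\<And>t x. t \<in> J \<Longrightarrow> 0 < f t x"
    and \<phi>: "\<And>r. 0 < r \<Longrightarrow> (\<phi> has_field_derivative \<phi>' r) (at r)" and c: "continuous_on {0<..} \<phi>'"
  shows "C1_derivs J (\<lambda>t x. \<phi> (f t x)) (\<lambda>t x. \<phi>' (f t x) * ft t x) (\<lambda>j t x. \<phi>' (f t x) * fx j t x)"
proof -
  have c': "continuous_on (J \<times> UNIV) (\<lambda>z. \<phi>' (f (fst z) (snd z)))"
    by (rule continuous_on_compose2[OF c C1_derivs_continuous[OF f]]) (use pos in auto)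
  show ?thesis
    unfolding C1_derivs_def
  proof (intro conjI ballI allI continuous_on_mult c' C1_derivsD[OF f])
    fix t x assume t: "t \<in> J"
    have "(\<phi> has_derivative (\<lambda>h. \<phi>' (f t x) * h)) (at (f (fst (t, x)) (snd (t, x))) within UNIV)"
      using \<phi>[OF pos[OF t, of x]] by (simp add: has_field_derivative_def)
    from diff_chain_within[OF C1_derivsD(1)[OF f t] has_derivative_subset[OF this subset_UNIV]]
    show "((\<lambda>z. \<phi> (f (fst z) (snd z))) has_derivative
       (\<lambda>k. fst k *\<^sub>R (\<phi>' (f t x) * ft t x) + (\<Sum>j\<in>UNIV. snd k $ j *\<^sub>R (\<phi>' (f t x) * fx j t x)))) (at (t, x) within J \<times> UNIV)"
      by (simp add: o_def sum_distrib_left algebra_simps)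
  qed
qed

text \<open>The integral of a compactly supported function does not change under translation;
  its derivative along the translation is the integral of the partial derivative.\<close>

lemma integral_partial_zero:
  fixes g :: "real^'n \<Rightarrow> real"
  assumes g: "\<And>x. (g has_derivative (\<lambda>h. \<Sum>j\<in>UNIV. h $ j *\<^sub>R gx j x)) (at x)"
    and c: "continuous_on UNIV (gx j)"
    and supp: "\<And>x. r < norm x \<Longrightarrow> g x = 0"
    and d: "0 < d" "cball 0 (r + d) \<subseteq> cbox a b"
  shows "integral (cbox a b) (gx j) = 0"
proof -
  let ?e = "axis j 1 :: real^'n"
  have cg: "continuous_on S g" for S
    using g by (meson has_derivative_continuous continuous_at_imp_continuous_on)
  have gline: "((\<lambda>h. g (x + h *\<^sub>R ?e)) has_vector_derivative gx j (x + h *\<^sub>R ?e)) (at h within S)" for x h S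
  proof -
    have "(g \<circ> (\<lambda>h. x + h *\<^sub>R ?e) has_derivative
       (\<lambda>h'. \<Sum>i\<in>UNIV. h' $ i *\<^sub>R gx i (x + h *\<^sub>R ?e)) \<circ> (\<lambda>s. s *\<^sub>R ?e)) (at h within S)"
      by (rule diff_chain_within[OF _ has_derivative_at_withinI[OF g]]) (auto intro!: derivative_eq_intros)
    moreover have "(\<Sum>i\<in>UNIV. (s *\<^sub>R ?e) $ i *\<^sub>R gx i (x + h *\<^sub>R ?e)) = s *\<^sub>R gx j (x + h *\<^sub>R ?e)" for s
      using sum_axis_scaleR[of j "\<lambda>i. gx i (x + h *\<^sub>R ?e)"]
      by (simp add: sum_distrib_left[symmetric] mult.assoc)
    ultimately show ?thesis by (simp add: has_vector_derivative_def o_def)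
  qed
  have "((\<lambda>h. integral (cbox a b) (\<lambda>x. g (x + h *\<^sub>R ?e))) has_vector_derivative
       integral (cbox a b) (\<lambda>x. gx j (x + 0 *\<^sub>R ?e))) (at 0 within {-d<..<d})"
  proof (rule leibniz_rule_vector_derivative[OF gline])
    show "(\<lambda>x. g (x + h *\<^sub>R ?e)) integrable_on cbox a b" for h
      by (intro integrable_continuous continuous_on_compose2[OF cg[of UNIV]] continuous_intros) auto
    show "continuous_on ({-d<..<d} \<times> cbox a b) (\<lambda>(h, x). gx j (x + h *\<^sub>R ?e))"
      unfolding case_prod_beta
      by (rule continuous_on_compose2[OF c]) (auto intro!: continuous_intros)
  qed (use d in auto)
  then have *: "((\<lambda>h. integral (cbox a b) (\<lambda>x. g (x + h *\<^sub>R ?e))) has_vector_derivative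
       integral (cbox a b) (gx j)) (at 0 within {-d<..<d})" by simp
  have const: "integral (cbox a b) (\<lambda>x. g (x + h *\<^sub>R ?e)) = integral UNIV g" if h: "h \<in> {-d<..<d}" for h
  proof -
    have "g x = 0" if "x \<notin> cbox a b" for x
    proof -
      have "x \<notin> cball 0 (r + d)" using d that by auto
      then show ?thesis using d by (intro supp) (auto simp: dist_norm)
    qed
    moreover have "x \<in> cbox (a + h *\<^sub>R ?e) (b + h *\<^sub>R ?e)" if "g x \<noteq> 0" for x
    proof -
      have "norm x \<le> r" using supp that by force
      moreover have "norm (h *\<^sub>R ?e) \<le> d" using h by (simp add: abs_le_iff)
      ultimately have "x - h *\<^sub>R ?e \<in> cball 0 (r + d)"
        using norm_triangle_ineq4[of x "h *\<^sub>R ?e"] by simp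
      then have "x - h *\<^sub>R ?e \<in> cbox a b" using d by blast
      then show ?thesis by (simp add: mem_box inner_diff_left inner_add_left algebra_simps)
    qed
    ultimately have "integral (cbox (a + h *\<^sub>R ?e) (b + h *\<^sub>R ?e)) g = integral UNIV g"
      by (intro integral_spike_set) (auto intro!: empty_imp_negligible)
    then show ?thesis
      using integral_shift_cbox_plus[of a b g "h *\<^sub>R ?e"] by (simp add: o_def add.commute)
  qed
  have "((\<lambda>h. integral UNIV g) has_vector_derivative integral (cbox a b) (gx j)) (at 0 within {-d<..<d})"
    by (rule has_vector_derivative_transform[OF _ _ *]) (use d const in auto)
  moreover have "at (0::real) within {-d<..<d} = at 0" using d by (intro at_within_open) auto
  ultimately have "((\<lambda>h. integral UNIV g) has_vector_derivative integral (cbox a b) (gx j)) (at 0)"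
    by simp
  then show ?thesis
    using vector_derivative_unique_at has_vector_derivative_const by blast
qed

section \<open>Material derivatives and transport\<close>

definition C1_material :: "real set \<Rightarrow> (real \<Rightarrow> real^'n \<Rightarrow> real^'n) \<Rightarrow>
    (real \<Rightarrow> real^'n \<Rightarrow> 'b::real_normed_vector) \<Rightarrow> (real \<Rightarrow> real^'n \<Rightarrow> 'b) \<Rightarrow> bool" where
  "C1_material J u f Df \<longleftrightarrow> (\<exists>ft fx. C1_derivs J f ft fx \<and>
     (\<forall>t\<in>J. \<forall>x. Df t x = ft t x + (\<Sum>j\<in>UNIV. u t x $ j *\<^sub>R fx j t x)))"

lemma C1_materialI:
  assumes "C1_derivs J f ft fx"
    and "\<And>t x. t \<in> J \<Longrightarrow> Df t x = ft t x + (\<Sum>j\<in>UNIV. u t x $ j *\<^sub>R fx j t x)"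
  shows "C1_material J u f Df"
  using assms by (auto simp: C1_material_def)

lemma C1_material_eq:
  assumes "C1_material J u f Df" and "\<And>t x. t \<in> J \<Longrightarrow> Df t x = Df' t x"
  shows "C1_material J u f Df'"
  using assms by (auto simp: C1_material_def)

lemma C1_material_const: "C1_material J u (\<lambda>t x. c) (\<lambda>t x. 0)"
  by (rule C1_materialI[OF C1_derivs_const]) simp

lemma C1_material_position: "C1_material J u (\<lambda>t x. x) u"
proof (rule C1_materialI[OF C1_derivs_position])
  show "u t x = 0 + (\<Sum>j\<in>UNIV. u t x $ j *\<^sub>R axis j 1)" for t x
    using basis_expansion[of "u t x"] by (simp add: scalar_mult_eq_scaleR)
qed

lemma C1_material_add:
  assumes "C1_material J u f Df" and "C1_material J u g Dg"
  shows "C1_material J u (\<lambda>t x. f t x + g t x) (\<lambda>t x. Df t x + Dg t x)"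
proof -
  obtain ft fx gt gx where f: "C1_derivs J f ft fx" and g: "C1_derivs J g gt gx"
    and "\<forall>t\<in>J. \<forall>x. Df t x = ft t x + (\<Sum>j\<in>UNIV. u t x $ j *\<^sub>R fx j t x)"
      "\<forall>t\<in>J. \<forall>x. Dg t x = gt t x + (\<Sum>j\<in>UNIV. u t x $ j *\<^sub>R gx j t x)"
    using assms by (auto simp: C1_material_def)
  then show ?thesis
    by (intro C1_materialI[OF C1_derivs_add[OF f g]]) (simp add: sum.distrib algebra_simps)
qed

lemma C1_material_linear:
  assumes "bounded_linear L" and "C1_material J u f Df"
  shows "C1_material J u (\<lambda>t x. L (f t x)) (\<lambda>t x. L (Df t x))"
proof -
  interpret bounded_linear L by fact
  obtain ft fx where f: "C1_derivs J f ft fx"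
    and "\<forall>t\<in>J. \<forall>x. Df t x = ft t x + (\<Sum>j\<in>UNIV. u t x $ j *\<^sub>R fx j t x)"
    using assms by (auto simp: C1_material_def)
  then show ?thesis
    by (intro C1_materialI[OF C1_derivs_linear[OF assms(1) f]]) (simp add: add sum scaleR)
qed

lemma C1_material_bilinear:
  assumes "bounded_bilinear B" and "C1_material J u f Df" and "C1_material J u g Dg"
  shows "C1_material J u (\<lambda>t x. B (f t x) (g t x)) (\<lambda>t x. B (f t x) (Dg t x) + B (Df t x) (g t x))"
proof -
  interpret bounded_bilinear B by fact
  obtain ft fx gt gx where f: "C1_derivs J f ft fx" and g: "C1_derivs J g gt gx"
    and "\<forall>t\<in>J. \<forall>x. Df t x = ft t x + (\<Sum>j\<in>UNIV. u t x $ j *\<^sub>R fx j t x)"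
      "\<forall>t\<in>J. \<forall>x. Dg t x = gt t x + (\<Sum>j\<in>UNIV. u t x $ j *\<^sub>R gx j t x)"
    using assms by (auto simp: C1_material_def)
  then show ?thesis
    by (intro C1_materialI[OF C1_derivs_bilinear[OF assms(1) f g]])
      (simp add: add_left add_right sum_left sum_right scaleR_left scaleR_right sum.distrib algebra_simps)
qed

lemma C1_material_compose:
  fixes f :: "real \<Rightarrow> real^'n \<Rightarrow> real"
  assumes "C1_material J u f Df" and pos: "\<And>t x. t \<in> J \<Longrightarrow> 0 < f t x"
    and \<phi>: "\<And>r. 0 < r \<Longrightarrow> (\<phi> has_field_derivative \<phi>' r) (at r)" and c: "continuous_on {0<..} \<phi>'"
  shows "C1_material J u (\<lambda>t x. \<phi> (f t x)) (\<lambda>t x. \<phi>' (f t x) * Df t x)"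
proof -
  obtain ft fx where f: "C1_derivs J f ft fx"
    and "\<forall>t\<in>J. \<forall>x. Df t x = ft t x + (\<Sum>j\<in>UNIV. u t x $ j *\<^sub>R fx j t x)"
    using assms by (auto simp: C1_material_def)
  then show ?thesis
    by (intro C1_materialI[OF C1_derivs_compose[OF f pos \<phi> c]]) (auto simp: sum_distrib_left algebra_simps)
qed

lemma transport_theorem:
  fixes \<rho> f :: "real \<Rightarrow> real^'n \<Rightarrow> real"
  assumes \<rho>: "C1_derivs J \<rho> \<rho>t \<rho>x" and u: "C1_derivs J u ut ux" and fD: "C1_material J u f Df"
    and mass: "\<And>t x. t \<in> J \<Longrightarrow> \<rho>t t x + (\<Sum>j\<in>UNIV. \<rho> t x * ux j t x $ j + \<rho>x j t x * u t x $ j) = 0"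
    and supp: "\<And>t x. t \<in> J \<Longrightarrow> r < norm x \<Longrightarrow> u t x = 0"
    and box: "0 < d" "cball 0 (r + d) \<subseteq> cbox a b"
    and J: "convex J" "t \<in> J"
  shows "((\<lambda>t. integral (cbox a b) (\<lambda>x. \<rho> t x * f t x)) has_real_derivative
     integral (cbox a b) (\<lambda>x. \<rho> t x * Df t x)) (at t within J)"
proof -
  obtain ft fx where f: "C1_derivs J f ft fx"
    and Df: "\<And>t x. t \<in> J \<Longrightarrow> Df t x = ft t x + (\<Sum>j\<in>UNIV. u t x $ j *\<^sub>R fx j t x)"
    using fD by (auto simp: C1_material_def)
  note \<rho>f = C1_derivs_bilinear[OF bounded_bilinear_mult \<rho> f]
  note flux = C1_derivs_bilinear[OF bounded_bilinear_mult \<rho>f C1_derivs_linear[OF bounded_linear_vec_nth u]]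
  let ?\<rho>ft = "\<lambda>t x. \<rho> t x * ft t x + \<rho>t t x * f t x"
  let ?flux = "\<lambda>j x. \<rho> t x * f t x * ux j t x $ j + (\<rho> t x * fx j t x + \<rho>x j t x * f t x) * u t x $ j"
  have flux_int: "integral (cbox a b) (?flux j) = 0" for j
    by (rule integral_partial_zero[OF C1_derivs_space[OF flux[of j] J(2)] _ _ box])
      (auto simp: supp[OF J(2)] intro!: continuous_on_slice[OF C1_derivsD(3)[OF flux] J(2)])
  have flux_integrable: "(?flux j) integrable_on cbox a b" for j
    by (intro integrable_continuous continuous_on_slice[OF C1_derivsD(3)[OF flux] J(2)])
  have "((\<lambda>t. integral (cbox a b) (\<lambda>x. \<rho> t x * f t x)) has_vector_derivative
     integral (cbox a b) (?\<rho>ft t)) (at t within J)"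
  proof (rule leibniz_rule_vector_derivative[OF C1_derivs_time[OF \<rho>f] _ _ J(2,1)])
    show "(\<lambda>x. \<rho> t x * f t x) integrable_on cbox a b" if "t \<in> J" for t
      by (intro integrable_continuous continuous_on_slice[OF C1_derivs_continuous[OF \<rho>f] that])
    show "continuous_on (J \<times> cbox a b) (\<lambda>(t, x). ?\<rho>ft t x)"
      unfolding case_prod_beta
      by (rule continuous_on_subset[OF C1_derivsD(2)[OF \<rho>f]]) auto
  qed
  moreover have "?\<rho>ft t x = \<rho> t x * Df t x - (\<Sum>j\<in>UNIV. ?flux j x)" for x
  proof -
    have "(\<Sum>j\<in>UNIV. ?flux j x) = f t x * (\<Sum>j\<in>UNIV. \<rho> t x * ux j t x $ j + \<rho>x j t x * u t x $ j)
        + \<rho> t x * (\<Sum>j\<in>UNIV. u t x $ j *\<^sub>R fx j t x)"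
      by (simp add: sum_distrib_left sum.distrib[symmetric] algebra_simps)
    moreover have "(\<Sum>j\<in>UNIV. \<rho> t x * ux j t x $ j + \<rho>x j t x * u t x $ j) = - \<rho>t t x"
      using mass[OF J(2), of x] by simp
    ultimately show ?thesis by (simp add: Df[OF J(2)] algebra_simps)
  qed
  moreover have "integral (cbox a b) (\<lambda>x. \<rho> t x * Df t x - (\<Sum>j\<in>UNIV. ?flux j x))
      = integral (cbox a b) (\<lambda>x. \<rho> t x * Df t x)"
  proof -
    have "(\<lambda>x. \<rho> t x * (ft t x + (\<Sum>j\<in>UNIV. u t x $ j *\<^sub>R fx j t x))) integrable_on cbox a b"
      by (intro integrable_continuous continuous_intros
          continuous_on_slice[OF C1_derivs_continuous[OF \<rho>] J(2)] continuous_on_slice[OF C1_derivsD(2)[OF f] J(2)]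
          continuous_on_slice[OF C1_derivs_continuous[OF u] J(2)] continuous_on_slice[OF C1_derivsD(3)[OF f] J(2)])
    then have "(\<lambda>x. \<rho> t x * Df t x) integrable_on cbox a b"
      by (simp add: Df[OF J(2)])
    then show ?thesis
      using flux_integrable by (simp add: integral_diff integrable_sum integral_sum flux_int)
  qed
  ultimately show ?thesis by (simp add: has_real_derivative_iff_has_vector_derivative)
qed

lemma integral_div_zero:
  fixes S :: "real \<Rightarrow> real^'n \<Rightarrow> real^'n^'m" and w :: "real \<Rightarrow> real^'n \<Rightarrow> real^'m"
  assumes w: "C1_derivs J w wt wx" and S: "C1_derivs J S St Sx"
    and supp: "\<And>x. r < norm x \<Longrightarrow> S t x = 0"
    and box: "0 < d" "cball 0 (r + d) \<subseteq> cbox a b"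
    and t: "t \<in> J"
  shows "((\<lambda>x. \<Sum>i\<in>UNIV. \<Sum>j\<in>UNIV. w t x $ i * Sx j t x $ i $ j + wx j t x $ i * S t x $ i $ j)
     has_integral 0) (cbox a b)"
proof -
  note flux = C1_derivs_bilinear[OF bounded_bilinear_mult C1_derivs_linear[OF bounded_linear_vec_nth w]
     C1_derivs_linear[OF bounded_linear_vec_nth C1_derivs_linear[OF bounded_linear_vec_nth S]]]
  have "((\<lambda>x. w t x $ i * Sx j t x $ i $ j + wx j t x $ i * S t x $ i $ j) has_integral 0) (cbox a b)" for i j
  proof -
    have c: "continuous_on D (\<lambda>x. w t x $ i * Sx j t x $ i $ j + wx j t x $ i * S t x $ i $ j)" for D
      by (rule continuous_on_slice[OF C1_derivsD(3)[OF flux] t])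
    show ?thesis
      using integral_partial_zero[OF C1_derivs_space[OF flux[of i i j] t] c _ box] supp
        integrable_continuous[OF c] by (simp add: has_integral_iff)
  qed
  then have "((\<lambda>x. \<Sum>i\<in>UNIV. \<Sum>j\<in>UNIV. w t x $ i * Sx j t x $ i $ j + wx j t x $ i * S t x $ i $ j)
     has_integral (\<Sum>i::'m\<in>UNIV. \<Sum>j::'n\<in>UNIV. 0)) (cbox a b)"
    by (intro has_integral_sum) auto
  then show ?thesis by simp
qed

lemma bounded_bilinear_matrix_mult:
  "bounded_bilinear ((**) :: real^'n^'m \<Rightarrow> real^'p^'n \<Rightarrow> real^'p^'m)"
  unfolding bilinear_conv_bounded_bilinear[symmetric] bilinear_def
  by (auto intro!: linearI simp: matrix_matrix_mult_def vec_eq_iff sum.distrib sum_distrib_left algebra_simps)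

interpretation matrix_mult: bounded_bilinear "(**) :: real^'n^'m \<Rightarrow> real^'p^'n \<Rightarrow> real^'p^'m"
  by (rule bounded_bilinear_matrix_mult)

lemma bounded_linear_transpose: "bounded_linear (transpose :: real^'n^'m \<Rightarrow> real^'m^'n)"
  unfolding linear_conv_bounded_linear[symmetric]
  by (auto intro!: linearI simp: transpose_def vec_eq_iff)

lemma bounded_linear_trace: "bounded_linear (trace :: real^'n^'n \<Rightarrow> real)"
  unfolding linear_conv_bounded_linear[symmetric]
  by (auto intro!: linearI simp: trace_def sum.distrib sum_distrib_left)

lemma trace_scaleR: "trace (c *\<^sub>R M) = c * trace (M :: real^'n^'n)"
  by (simp add: trace_def sum_distrib_left)

lemma trace_transpose: "trace (transpose M) = trace M"
  by (simp add: trace_def transpose_def)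

lemma trace_matrix_mult: "trace (M ** N) = (\<Sum>i\<in>UNIV. \<Sum>j\<in>UNIV. M $ i $ j * N $ j $ i)"
  by (simp add: trace_def matrix_matrix_mult_def)

lemma transpose_conjugation:
  fixes F A :: "real^'n^'n"
  assumes "transpose A = A"
  shows "transpose (F ** A ** transpose F) = F ** A ** transpose F"
  using assms by (simp add: matrix_transpose_mul matrix_mul_assoc)

lemma trace_conjugation_nonneg:
  fixes F A :: "real^3^3"
  assumes "sym_pos_def A"
  shows "0 \<le> trace (F ** A ** transpose F)"
proof -
  have "(F ** A ** transpose F) $ i $ i = F $ i \<bullet> (A *v F $ i)" for i
    by (simp add: matrix_matrix_mult_def transpose_def matrix_vector_mult_def inner_vec_def
        sum_distrib_left sum_distrib_right algebra_simps) (subst sum.swap, simp add: ac_simps)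
  moreover have "0 \<le> F $ i \<bullet> (A *v F $ i)" for i
    using assms by (cases "F $ i = 0") (auto simp: sym_pos_def_def intro: less_imp_le)
  ultimately show ?thesis by (simp add: trace_def sum_nonneg)
qed

section \<open>The virial identity\<close>

text \<open>The function \<open>P\<close> of the density solves \<open>r\<^sup>2 P'(r) = 2 (p(r) - a) + 2 G r\<close>, which cancels
  the compression terms of the energy balance; the term \<open>2 a / r\<close> accounts for the background pressure.\<close>

definition entropy :: "real \<Rightarrow> real \<Rightarrow> real \<Rightarrow> real \<Rightarrow> real" where
  "entropy a \<gamma> G r = 2 * a / (\<gamma> - 1) * r powr (\<gamma> - 1) + 2 * a / r + 2 * G * ln r"

definition entropy' :: "real \<Rightarrow> real \<Rightarrow> real \<Rightarrow> real \<Rightarrow> real" where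
  "entropy' a \<gamma> G r = (2 * (pressure a \<gamma> r - a) + 2 * G * r) / r\<^sup>2"

lemma entropy_has_derivative:
  assumes "1 < \<gamma>" and "0 < r"
  shows "(entropy a \<gamma> G has_field_derivative entropy' a \<gamma> G r) (at r)"
proof -
  have p: "r powr \<gamma> = r powr (\<gamma> - 1 - 1) * r\<^sup>2"
    using assms powr_add[of r "\<gamma> - 2" 2] by (simp add: algebra_simps)
  have inv: "((\<lambda>r. 2 * a / r) has_field_derivative - (2 * a / r\<^sup>2)) (at r)"
    and ln: "((\<lambda>r. 2 * G * ln r) has_field_derivative 2 * G * (1 / r)) (at r)"
    using assms by (auto intro!: derivative_eq_intros simp: power2_eq_square)
  have "((\<lambda>r. 2 * a / (\<gamma> - 1) * r powr (\<gamma> - 1) + 2 * a / r + 2 * G * ln r) has_field_derivative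
      2 * a / (\<gamma> - 1) * ((\<gamma> - 1) * r powr (\<gamma> - 1 - 1)) + - (2 * a / r\<^sup>2) + 2 * G * (1 / r)) (at r)"
    by (intro DERIV_add DERIV_cmult has_real_derivative_powr inv ln assms(2))
  moreover have "2 * a / (\<gamma> - 1) * ((\<gamma> - 1) * r powr (\<gamma> - 1 - 1)) = 2 * a * r powr (\<gamma> - 1 - 1)"
    using assms by simp
  moreover have "2 * a * r powr (\<gamma> - 1 - 1) + - (2 * a / r\<^sup>2) + 2 * G * (1 / r) = entropy' a \<gamma> G r"
    using assms unfolding entropy'_def pressure_def p by (simp add: field_simps power2_eq_square)
  ultimately show ?thesis by (simp only: entropy_def[abs_def])
qed

lemma entropy'_continuous: "continuous_on {0<..} (entropy' a \<gamma> G)"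
  unfolding entropy'_def pressure_def by (intro continuous_intros) auto

lemma pressure_has_derivative:
  assumes "0 < r"
  shows "(pressure a \<gamma> has_field_derivative a * (\<gamma> * r powr (\<gamma> - 1))) (at r)"
  unfolding pressure_def[abs_def] using assms by (auto intro!: derivative_eq_intros)

lemma pressure'_continuous: "continuous_on {0<..} (\<lambda>r. a * (\<gamma> * r powr (\<gamma> - 1)))"
  for a \<gamma> :: real
  by (intro continuous_intros) auto

locale viscoelastic_flow =
  fixes lam \<mu>\<^sub>0 a \<gamma> :: real and J :: "real set"
    and \<rho> :: "real \<Rightarrow> real^3 \<Rightarrow> real" and u :: "real \<Rightarrow> real^3 \<Rightarrow> real^3"
    and A F :: "real \<Rightarrow> real^3 \<Rightarrow> real^3^3"
  assumes lam: "0 < lam" and \<mu>: "0 < \<mu>\<^sub>0" and a: "0 < a" and \<gamma>: "1 < \<gamma>"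
    and J: "convex J" "\<And>t. t \<in> J \<Longrightarrow> at t within J \<noteq> bot"
    and sol: "C1_solution lam \<mu>\<^sub>0 a \<gamma> J \<rho> u A F"
begin

definition conf :: "real \<Rightarrow> real^3 \<Rightarrow> real^3^3" where
  "conf t x = F t x ** A t x ** transpose (F t x)"

definition total_stress :: "real \<Rightarrow> real^3 \<Rightarrow> real^3^3" where
  "total_stress t x = stress lam \<mu>\<^sub>0 (\<rho> t x) (A t x) (F t x) + (a - pressure a \<gamma> (\<rho> t x)) *\<^sub>R mat 1"

definition virial :: "real \<Rightarrow> real^3 \<Rightarrow> real" where
  "virial t x = x \<bullet> u t x - lam * (u t x \<bullet> u t x
     + (\<mu>\<^sub>0 / lam) * trace (conf t x) + entropy a \<gamma> (\<mu>\<^sub>0 / lam) (\<rho> t x))"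

lemma pos: "t \<in> J \<Longrightarrow> 0 < \<rho> t x"
  and spd: "t \<in> J \<Longrightarrow> sym_pos_def (A t x)"
  and invF: "t \<in> J \<Longrightarrow> invertible (F t x)"
  using sol by (auto simp: C1_solution_def)

lemma virial_identity:
  obtains \<rho>t \<rho>x ut ux St Sx Dv where
    "C1_derivs J \<rho> \<rho>t \<rho>x" "C1_derivs J u ut ux" "C1_derivs J total_stress St Sx"
    "C1_material J u virial Dv"
    "\<And>t x. t \<in> J \<Longrightarrow> \<rho>t t x + (\<Sum>j\<in>UNIV. \<rho> t x * ux j t x $ j + \<rho>x j t x * u t x $ j) = 0"
    "\<And>t x. t \<in> J \<Longrightarrow> \<rho> t x * Dv t x = \<rho> t x * (u t x \<bullet> u t x) + 3 * (pressure a \<gamma> (\<rho> t x) - a)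
       + (\<Sum>i\<in>UNIV. \<Sum>j\<in>UNIV. (x - (2 * lam) *\<^sub>R u t x) $ i * Sx j t x $ i $ j
            + (axis j 1 - (2 * lam) *\<^sub>R ux j t x) $ i * total_stress t x $ i $ j)"
proof -
  obtain \<rho>t \<rho>x where \<rho>: "C1_derivs J \<rho> \<rho>t \<rho>x" using sol by (auto simp: C1_solution_def elim: C1_derivs_exists)
  obtain ut ux where u: "C1_derivs J u ut ux" using sol by (auto simp: C1_solution_def elim: C1_derivs_exists)
  obtain At Ax where A: "C1_derivs J A At Ax" using sol by (auto simp: C1_solution_def elim: C1_derivs_exists)
  obtain Ft Fx where F: "C1_derivs J F Ft Fx" using sol by (auto simp: C1_solution_def elim: C1_derivs_exists)
  let ?G = "\<mu>\<^sub>0 / lam"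
  define D\<rho> where "D\<rho> t x = \<rho>t t x + (\<Sum>j\<in>UNIV. u t x $ j *\<^sub>R \<rho>x j t x)" for t x
  define Du where "Du t x = ut t x + (\<Sum>j\<in>UNIV. u t x $ j *\<^sub>R ux j t x)" for t x
  define DA where "DA t x = At t x + (\<Sum>j\<in>UNIV. u t x $ j *\<^sub>R Ax j t x)" for t x
  define DF where "DF t x = Ft t x + (\<Sum>j\<in>UNIV. u t x $ j *\<^sub>R Fx j t x)" for t x
  define L where "L t x = (\<chi> i j. ux j t x $ i)" for t x

  note C1F = C1_derivs_bilinear[OF bounded_bilinear_matrix_mult]
  note C1conf = C1F[OF C1F[OF F A] C1_derivs_linear[OF bounded_linear_transpose F]]
  note C1p = C1_derivs_compose[OF \<rho> pos pressure_has_derivative pressure'_continuous, of a \<gamma>]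
  note C1T = C1_derivs_bilinear[OF bounded_bilinear_scaleR
      C1_derivs_linear[OF bounded_linear_mult_left[of ?G] \<rho>]
      C1_derivs_add[OF C1conf C1_derivs_const[of J "- mat 1"]]]
  obtain Tt Tx where T: "C1_derivs J (\<lambda>t x. stress lam \<mu>\<^sub>0 (\<rho> t x) (A t x) (F t x)) Tt Tx"
    using C1T by (auto simp: stress_def)
  note C1q = C1_derivs_bilinear[OF bounded_bilinear_scaleR
      C1_derivs_add[OF C1_derivs_const[of J a] C1_derivs_linear[OF bounded_linear_minus[OF bounded_linear_ident] C1p]]
      C1_derivs_const[of J "mat 1 :: real^3^3"]]
  obtain Sx St where S: "C1_derivs J total_stress St Sx"
    and Sx: "\<And>j t x. Sx j t x = Tx j t x - (a * (\<gamma> * \<rho> t x powr (\<gamma> - 1)) * \<rho>x j t x) *\<^sub>R mat 1"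
    using C1_derivs_add[OF T C1q] by (simp add: total_stress_def[abs_def])

  have mass: "\<rho>t t x + (\<Sum>j\<in>UNIV. \<rho> t x * ux j t x $ j + \<rho>x j t x * u t x $ j) = 0"
    and mom: "\<rho> t x *\<^sub>R Du t x + (\<chi> j. a * (\<gamma> * \<rho> t x powr (\<gamma> - 1)) * \<rho>x j t x) = (\<chi> i. \<Sum>j\<in>UNIV. Tx j t x $ i $ j)"
    and Aeq: "lam *\<^sub>R DA t x + A t x = matrix_inv (F t x) ** transpose (matrix_inv (F t x))"
    and Feq: "DF t x = L t x ** F t x"
    if t: "t \<in> J" for t x
  proof -
    have vd: "vector_derivative (\<lambda>s. f s x) (at t within J) = ft t x" if "C1_derivs J f ft fx"
      for f :: "real \<Rightarrow> real^3 \<Rightarrow> 'c::real_normed_vector" and ft fx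
      by (rule vector_derivative_within[OF J(2)[OF t] C1_derivs_time[OF that t]])
    have flux: "partial j (\<lambda>y. \<rho> t y * u t y $ j) x = \<rho> t x * ux j t x $ j + \<rho>x j t x * u t x $ j" for j
      using C1_derivs_partial[OF C1_derivs_bilinear[OF bounded_bilinear_mult \<rho>
          C1_derivs_linear[OF bounded_linear_vec_nth u]] t, of j] by simp
    have uj: "partial j (\<lambda>y. u t y $ i) x = ux j t x $ i" for i j
      by (rule C1_derivs_partial[OF C1_derivs_linear[OF bounded_linear_vec_nth u] t])
    have Tj: "partial j (\<lambda>y. stress lam \<mu>\<^sub>0 (\<rho> t y) (A t y) (F t y) $ i $ k) x = Tx j t x $ i $ k" for i j k
      by (rule C1_derivs_partial[OF C1_derivs_linear[OF bounded_linear_vec_nth C1_derivs_linear[OF bounded_linear_vec_nth T]] t])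
    note eqs = sol[unfolded C1_solution_def, THEN conjunct2, THEN conjunct2, THEN conjunct2, THEN conjunct2,
        THEN conjunct2, rule_format, OF t, of x]
    note simps = vd[OF \<rho>] vd[OF u] vd[OF A] vd[OF F] div_vec_def grad_def div_mat_def grad_vec_def advect_def
      flux uj Tj C1_derivs_partial[OF u t] C1_derivs_partial[OF A t] C1_derivs_partial[OF F t]
      C1_derivs_partial[OF C1p t] L_def Du_def DA_def DF_def scaleR_add_right
    from eqs show "\<rho>t t x + (\<Sum>j\<in>UNIV. \<rho> t x * ux j t x $ j + \<rho>x j t x * u t x $ j) = 0"
      and "\<rho> t x *\<^sub>R Du t x + (\<chi> j. a * (\<gamma> * \<rho> t x powr (\<gamma> - 1)) * \<rho>x j t x) = (\<chi> i. \<Sum>j\<in>UNIV. Tx j t x $ i $ j)"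
      and "lam *\<^sub>R DA t x + A t x = matrix_inv (F t x) ** transpose (matrix_inv (F t x))"
      and "DF t x = L t x ** F t x"
      by (simp_all add: simps)
  qed
  have mu: "C1_material J u u Du" and m\<rho>: "C1_material J u \<rho> D\<rho>"
    and mA: "C1_material J u A DA" and mF: "C1_material J u F DF"
    by (auto intro: C1_materialI[OF u] C1_materialI[OF \<rho>] C1_materialI[OF A] C1_materialI[OF F]
        simp: Du_def D\<rho>_def DA_def DF_def)
  have D\<rho>: "D\<rho> t x = - \<rho> t x * trace (L t x)" if "t \<in> J" for t x
    using mass[OF that, of x] by (simp add: D\<rho>_def L_def trace_def sum.distrib sum_distrib_left sum_negf algebra_simps)
  have \<rho>Du: "\<rho> t x * Du t x $ i = (\<Sum>j\<in>UNIV. Sx j t x $ i $ j)" if "t \<in> J" for t x i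
  proof -
    have "\<rho> t x * Du t x $ i + a * (\<gamma> * \<rho> t x powr (\<gamma> - 1)) * \<rho>x i t x = (\<Sum>j\<in>UNIV. Tx j t x $ i $ j)"
      using arg_cong[OF mom[OF that, of x], of "\<lambda>v. v $ i"] by simp
    moreover have "(\<Sum>j\<in>UNIV. a * (\<gamma> * \<rho> t x powr (\<gamma> - 1)) * \<rho>x j t x * (mat 1 :: real^3^3) $ i $ j)
        = a * (\<gamma> * \<rho> t x powr (\<gamma> - 1)) * \<rho>x i t x"
      by (simp add: mat_def if_distrib cong: if_cong)
    ultimately show ?thesis by (simp add: Sx sum_subtractf)
  qed

  note bm = C1_material_bilinear[OF bounded_bilinear_matrix_mult]
  have "C1_material J u (\<lambda>t x. trace (conf t x)) (\<lambda>t x. 2 * trace (L t x ** conf t x) + (3 - trace (conf t x)) / lam)"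
    unfolding conf_def
  proof (rule C1_material_eq[OF C1_material_linear[OF bounded_linear_trace
          bm[OF bm[OF mF mA] C1_material_linear[OF bounded_linear_transpose mF]]]])
    fix t x assume t: "t \<in> J"
    let ?F = "F t x" and ?A = "A t x" and ?L = "L t x" and ?I = "matrix_inv (F t x)"
    let ?B = "?F ** ?A ** transpose ?F"
    have FI: "?F ** ?I = mat 1"
      using someI_ex[OF invF[OF t, of x, unfolded invertible_def]] by (simp add: matrix_inv_def)
    have symA: "transpose ?A = ?A" using spd[OF t] by (simp add: sym_pos_def_def)
    have "lam *\<^sub>R DA t x = ?I ** transpose ?I - ?A"
      using Aeq[OF t, of x] by (simp add: eq_diff_eq)
    then have "(1 / lam) *\<^sub>R (lam *\<^sub>R DA t x) = (1 / lam) *\<^sub>R (?I ** transpose ?I - ?A)"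
      by (rule arg_cong)
    then have DA: "DA t x = (1 / lam) *\<^sub>R (?I ** transpose ?I - ?A)"
      using lam by simp
    have "?F ** (?I ** transpose ?I - ?A) ** transpose ?F
       = (?F ** ?I) ** transpose (?F ** ?I) - ?B"
      by (simp only: matrix_mult.diff_left matrix_mult.diff_right matrix_transpose_mul matrix_mul_assoc)
    then have "?F ** DA t x ** transpose ?F = (1 / lam) *\<^sub>R (mat 1 - ?B)"
      unfolding DA by (simp add: FI matrix_mult.scaleR_left matrix_mult.scaleR_right)
    moreover have "?F ** ?A ** transpose (?L ** ?F) = transpose (?L ** ?B)"
      using symA by (simp add: matrix_transpose_mul matrix_mul_assoc)
    ultimately show "trace (?F ** ?A ** transpose (DF t x) + (?F ** DA t x + DF t x ** ?A) ** transpose ?F)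
      = 2 * trace (?L ** ?B) + (3 - trace ?B) / lam"
      by (simp add: Feq[OF t] trace_transpose matrix_mult.add_left matrix_mul_assoc trace_add trace_sub trace_I trace_scaleR)
  qed
  note mtr = this
  note bi = C1_material_bilinear[OF bounded_bilinear_inner]
  note mul = C1_material_linear[OF bounded_linear_mult_right]
  note mE = C1_material_compose[OF m\<rho> pos entropy_has_derivative[OF \<gamma>, where a = a and G = ?G] entropy'_continuous]
  define Dv where "Dv t x = x \<bullet> Du t x + u t x \<bullet> u t x - lam * (u t x \<bullet> Du t x + Du t x \<bullet> u t x
     + ?G * (2 * trace (L t x ** conf t x) + (3 - trace (conf t x)) / lam)
     + entropy' a \<gamma> ?G (\<rho> t x) * D\<rho> t x)" for t x
  have "C1_material J u virial Dv"
    unfolding virial_def[abs_def] diff_conv_add_uminus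
    using C1_material_add[OF bi[OF C1_material_position mu]
        C1_material_linear[OF bounded_linear_minus[OF bounded_linear_ident]
          mul[OF C1_material_add[OF C1_material_add[OF bi[OF mu mu] mul[OF mtr, of ?G]] mE], of lam]]]
    by (rule C1_material_eq) (simp_all add: Dv_def)
  moreover have "\<rho> t x * Dv t x = \<rho> t x * (u t x \<bullet> u t x) + 3 * (pressure a \<gamma> (\<rho> t x) - a)
       + (\<Sum>i\<in>UNIV. \<Sum>j\<in>UNIV. (x - (2 * lam) *\<^sub>R u t x) $ i * Sx j t x $ i $ j
            + (axis j 1 - (2 * lam) *\<^sub>R ux j t x) $ i * total_stress t x $ i $ j)" if t: "t \<in> J" for t x
  proof -
    let ?r = "\<rho> t x" and ?B = "conf t x" and ?p = "pressure a \<gamma> (\<rho> t x)" and ?L = "L t x"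
    have tB: "transpose ?B = ?B"
      unfolding conf_def using spd[OF t] by (intro transpose_conjugation) (simp add: sym_pos_def_def)
    have symB: "?B $ i $ j = ?B $ j $ i" for i j
      using arg_cong[OF tB, of "\<lambda>M. M $ j $ i"] by (simp add: transpose_def)
    have S_eq: "total_stress t x $ i $ j = ?r * ?G * ?B $ i $ j - (?r * ?G + (?p - a)) * (mat 1 :: real^3^3) $ i $ j" for i j
      by (simp add: total_stress_def stress_def conf_def[symmetric] algebra_simps)
    have delta: "(\<Sum>i\<in>UNIV. \<Sum>j\<in>UNIV. M $ i $ j * (mat 1 :: real^3^3) $ i $ j) = trace M" for M :: "real^3^3"
      by (simp add: mat_def if_distrib trace_def cong: if_cong)
    have LS: "(\<Sum>i\<in>UNIV. \<Sum>j\<in>UNIV. M $ i $ j * total_stress t x $ i $ j)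
        = ?r * ?G * trace (M ** ?B) - (?r * ?G + (?p - a)) * trace M" for M :: "real^3^3"
    proof -
      have "(\<Sum>i\<in>UNIV. \<Sum>j\<in>UNIV. M $ i $ j * total_stress t x $ i $ j)
        = ?r * ?G * (\<Sum>i\<in>UNIV. \<Sum>j\<in>UNIV. M $ i $ j * ?B $ i $ j)
          - (?r * ?G + (?p - a)) * (\<Sum>i\<in>UNIV. \<Sum>j\<in>UNIV. M $ i $ j * (mat 1 :: real^3^3) $ i $ j)"
        unfolding S_eq sum_distrib_left sum_subtractf[symmetric] by (simp add: algebra_simps)
      also have "(\<Sum>i\<in>UNIV. \<Sum>j\<in>UNIV. M $ i $ j * ?B $ i $ j) = trace (M ** ?B)"
        unfolding trace_matrix_mult using symB by simp
      finally show ?thesis by (simp add: delta)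
    qed
    have work: "(\<Sum>i\<in>UNIV. \<Sum>j\<in>UNIV. (w :: real^3) $ i * Sx j t x $ i $ j) = ?r * (w \<bullet> Du t x)" for w
      by (simp add: inner_vec_def sum_distrib_left[symmetric] \<rho>Du[OF t, symmetric])
        (simp add: sum_distrib_left algebra_simps)
    have grad_w: "(axis j 1 - (2 * lam) *\<^sub>R ux j t x) $ i = (mat 1 - (2 * lam) *\<^sub>R ?L) $ i $ j" for i j
      by (simp add: axis_def mat_def L_def)
    have mat: "trace ((mat 1 - (2 * lam) *\<^sub>R ?L) ** ?B) = trace ?B - 2 * lam * trace (?L ** ?B)"
      "trace (mat 1 - (2 * lam) *\<^sub>R ?L) = 3 - 2 * lam * trace ?L"
      by (simp_all add: matrix_mult.diff_left matrix_mult.scaleR_left trace_sub trace_I trace_scaleR)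
    have ent: "?r * (entropy' a \<gamma> ?G ?r * D\<rho> t x) = - (2 * (?p - a) + 2 * ?G * ?r) * trace ?L"
      using pos[OF t, of x] by (simp add: D\<rho>[OF t] entropy'_def power2_eq_square) (simp add: algebra_simps)
    have "\<rho> t x * (u t x \<bullet> u t x) + 3 * (?p - a)
       + (\<Sum>i\<in>UNIV. \<Sum>j\<in>UNIV. (x - (2 * lam) *\<^sub>R u t x) $ i * Sx j t x $ i $ j
            + (axis j 1 - (2 * lam) *\<^sub>R ux j t x) $ i * total_stress t x $ i $ j)
       = ?r * (u t x \<bullet> u t x) + 3 * (?p - a) + ?r * ((x - (2 * lam) *\<^sub>R u t x) \<bullet> Du t x)
         + ?r * ?G * (trace ?B - 2 * lam * trace (?L ** ?B))
         - (?r * ?G + (?p - a)) * (3 - 2 * lam * trace ?L)"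
      by (simp only: sum.distrib work grad_w LS mat)
    also have "\<dots> = ?r * (u t x \<bullet> u t x) + ?r * ((x - (2 * lam) *\<^sub>R u t x) \<bullet> Du t x)
         + ?r * ?G * (trace ?B - 3 - 2 * lam * trace (?L ** ?B))
         + lam * ((2 * (?p - a) + 2 * ?G * ?r) * trace ?L)"
      by (simp add: algebra_simps)
    also have "\<dots> = ?r * (u t x \<bullet> u t x) + ?r * ((x - (2 * lam) *\<^sub>R u t x) \<bullet> Du t x)
         + ?r * ?G * (trace ?B - 3 - 2 * lam * trace (?L ** ?B))
         - lam * (?r * (entropy' a \<gamma> ?G ?r * D\<rho> t x))"
      by (simp only: ent)
    also have "\<dots> = ?r * Dv t x"
    proof -
      have *: "r * uu + r * (xD - 2 * lam * uD) + r * g * (tB - 3 - 2 * lam * tLB) - lam * (r * e)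
          = r * (xD + uu - lam * (uD + uD + g * (2 * tLB + k) + e))" if "tB = 3 - lam * k"
        for r uu xD uD g tB tLB k e :: real
        unfolding that by (simp add: algebra_simps)
      show ?thesis
        unfolding Dv_def inner_diff_left inner_scaleR_left inner_commute[of "Du t x"]
        by (rule *) (use lam in simp)
    qed
    finally show ?thesis by simp
  qed
  ultimately show thesis
    using that \<rho> u S mass by blast
qed

end

section \<open>Smooth bump functions\<close>

lemma Ck_Suc_intro:
  assumes "\<And>x. (f has_derivative f' x) (at x)" and "\<And>v. Ck k (\<lambda>x. f' x v)"
  shows "Ck (Suc k) f"
proof -
  have "frechet_derivative f (at x) = f' x" for x
    using frechet_derivative_at[OF assms(1)] by simp
  then show ?thesis using assms by (auto simp: differentiable_def)
qed

lemma Ck_Suc_elim: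
  assumes "Ck (Suc k) f"
  obtains f' where "\<And>x. (f has_derivative f' x) (at x)" and "\<And>v. Ck k (\<lambda>x. f' x v)"
  using assms that[of "\<lambda>x. frechet_derivative f (at x)"] by (auto simp: frechet_derivative_works)

lemma Ck_Suc_imp_Ck: "Ck (Suc k) f \<Longrightarrow> Ck k f"
proof (induction k arbitrary: f)
  case 0
  then show ?case
    by (auto intro: continuous_at_imp_continuous_on differentiable_imp_continuous_within)
next
  case (Suc k)
  from Suc.prems show ?case
    by (rule Ck_Suc_elim) (use Suc.IH in \<open>blast intro: Ck_Suc_intro\<close>)
qed

lemma Ck_const: "Ck k (\<lambda>x. c)"
proof (induction k arbitrary: c)
  case (Suc k)
  then show ?case by (intro Ck_Suc_intro[of _ "\<lambda>x h. 0"]) auto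
qed simp

lemma Ck_bounded_linear: "bounded_linear L \<Longrightarrow> Ck k L"
proof (cases k)
  case 0
  assume "bounded_linear L"
  then show ?thesis by (simp add: 0 linear_continuous_on)
next
  case (Suc k')
  assume L: "bounded_linear L"
  show ?thesis
    unfolding Suc by (rule Ck_Suc_intro[of L "\<lambda>x. L", OF bounded_linear_imp_has_derivative[OF L] Ck_const])
qed

lemma Ck_add: "Ck k f \<Longrightarrow> Ck k g \<Longrightarrow> Ck k (\<lambda>x. f x + g x)"
proof (induction k arbitrary: f g)
  case 0
  then show ?case by (auto intro: continuous_on_add)
next
  case (Suc k)
  obtain f' where f: "\<And>x. (f has_derivative f' x) (at x)" "\<And>v. Ck k (\<lambda>x. f' x v)"
    using Ck_Suc_elim[OF Suc.prems(1)] by metis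
  obtain g' where g: "\<And>x. (g has_derivative g' x) (at x)" "\<And>v. Ck k (\<lambda>x. g' x v)"
    using Ck_Suc_elim[OF Suc.prems(2)] by metis
  show ?case
    by (rule Ck_Suc_intro[OF has_derivative_add[OF f(1) g(1)] Suc.IH[OF f(2) g(2)]])
qed

lemma Ck_bilinear:
  assumes "bounded_bilinear B"
  shows "Ck k f \<Longrightarrow> Ck k g \<Longrightarrow> Ck k (\<lambda>x. B (f x) (g x))"
proof (induction k arbitrary: f g)
  case 0
  then show ?case using bounded_bilinear.continuous_on[OF assms] by auto
next
  case (Suc k)
  obtain f' where f: "\<And>x. (f has_derivative f' x) (at x)" "\<And>v. Ck k (\<lambda>x. f' x v)"
    using Ck_Suc_elim[OF Suc.prems(1)] by metis
  obtain g' where g: "\<And>x. (g has_derivative g' x) (at x)" "\<And>v. Ck k (\<lambda>x. g' x v)"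
    using Ck_Suc_elim[OF Suc.prems(2)] by metis
  have "Ck k f" "Ck k g" using Suc.prems by (blast intro: Ck_Suc_imp_Ck)+
  then show ?case
    by (intro Ck_Suc_intro[OF bounded_bilinear.FDERIV[OF assms f(1) g(1)]] Ck_add Suc.IH f(2) g(2))
qed

definition flat :: "nat \<Rightarrow> real \<Rightarrow> real" where
  "flat n t = (if 0 < t then (1 / t) ^ n * exp (- (1 / t)) else 0)"

lemma flat_tendsto_0: "(flat n \<longlongrightarrow> 0) (at 0)"
proof (rule filterlim_split_at)
  have "eventually (\<lambda>t. flat n t = 0) (at_left 0)"
    by (auto simp: flat_def eventually_at_filter)
  then show "(flat n \<longlongrightarrow> 0) (at_left 0)"
    using tendsto_eventually by blast
  have "((\<lambda>t. inverse t ^ n / exp (inverse t)) \<longlongrightarrow> (0::real)) (at_right 0)"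
    by (rule filterlim_compose[OF tendsto_power_div_exp_0 filterlim_inverse_at_top_right])
  moreover have "eventually (\<lambda>t. inverse t ^ n / exp (inverse t) = flat n t) (at_right 0)"
    by (auto simp: flat_def eventually_at_filter exp_minus divide_simps)
  ultimately show "(flat n \<longlongrightarrow> 0) (at_right 0)"
    by (rule Lim_transform_eventually)
qed

lemma flat_has_derivative:
  "(flat n has_field_derivative flat (n + 2) t - real n * flat (n + 1) t) (at t)"
proof (cases "t = 0")
  case True
  have "((\<lambda>h. (flat n (0 + h) - flat n 0) / h) \<longlongrightarrow> 0) (at 0)"
    by (rule Lim_transform_eventually[OF flat_tendsto_0[of "Suc n"]])
      (auto simp: flat_def eventually_at_filter)
  then show ?thesis using True by (simp add: DERIV_def flat_def)
next
  case False
  consider "t < 0" | "0 < t" using False by linarith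
  then show ?thesis
  proof cases
    case 1
    have "(flat n has_field_derivative 0) (at t)"
      by (rule has_field_derivative_transform_within_open[OF DERIV_const[of 0], of "{..<0}"])
        (use 1 in \<open>auto simp: flat_def\<close>)
    then show ?thesis using 1 by (simp add: flat_def)
  next
    case 2
    have inv: "((\<lambda>t. 1 / t) has_field_derivative - (1 / t)\<^sup>2) (at t)"
      using 2 by (auto intro!: derivative_eq_intros simp: power2_eq_square field_simps)
    have "((\<lambda>t. (1 / t) ^ n * exp (- (1 / t))) has_field_derivative
        (real n * (- (1 / t)\<^sup>2 * (1 / t) ^ (n - Suc 0))) * exp (- (1 / t))
         + exp (- (1 / t)) * - (- (1 / t)\<^sup>2) * (1 / t) ^ n) (at t)"
      by (rule DERIV_mult[OF DERIV_power[OF inv] DERIV_fun_exp[OF DERIV_minus[OF inv]]])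
    also have "(real n * (- (1 / t)\<^sup>2 * (1 / t) ^ (n - Suc 0))) * exp (- (1 / t))
         + exp (- (1 / t)) * - (- (1 / t)\<^sup>2) * (1 / t) ^ n = flat (n + 2) t - real n * flat (n + 1) t"
      using 2 by (cases n) (auto simp: flat_def power2_eq_square power_add algebra_simps)
    finally show ?thesis
      by (rule has_field_derivative_transform_within_open[of _ _ _ "{0<..}"])
        (use 2 in \<open>auto simp: flat_def\<close>)
  qed
qed

lemma Ck_flat:
  assumes "\<And>k. Ck k q"
  shows "Ck k (\<lambda>x. flat n (q x))"
proof (induction k arbitrary: n)
  case 0
  have "continuous_on UNIV (flat n)"
    using flat_has_derivative by (meson DERIV_isCont continuous_at_imp_continuous_on)
  moreover have "continuous_on UNIV q" using assms[of 0] by simp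
  ultimately show ?case by (auto intro: continuous_on_compose2)
next
  case (Suc k)
  obtain q' where q: "\<And>x. (q has_derivative q' x) (at x)" "\<And>v. Ck k (\<lambda>x. q' x v)"
    using Ck_Suc_elim[OF assms[of "Suc k"]] by metis
  have "((\<lambda>x. flat n (q x)) has_derivative
      (\<lambda>v. (flat (n + 2) (q x) + (- real n) * flat (n + 1) (q x)) * q' x v)) (at x)" for x
    using has_derivative_compose[OF q(1) flat_has_derivative[of n "q x", unfolded has_field_derivative_def]]
    by simp
  then show ?case
    by (rule Ck_Suc_intro) (intro Ck_add Ck_bilinear[OF bounded_bilinear_mult] Ck_const Suc.IH q(2))
qed

definition bump :: "real \<Rightarrow> 'a::euclidean_space \<Rightarrow> real" where
  "bump R x = flat 0 (1 - (x \<bullet> x) / R\<^sup>2)"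

lemma smooth_bump_field: "smooth (\<lambda>x. (b * bump R x) *\<^sub>R x)"
  unfolding smooth_def
proof
  fix k
  have "Ck k (\<lambda>x. 1 + (- (1 / R\<^sup>2)) * (x \<bullet> x))" for k and x :: 'a
    by (intro Ck_add Ck_bilinear[OF bounded_bilinear_mult] Ck_const Ck_bilinear[OF bounded_bilinear_inner]
        Ck_bounded_linear bounded_linear_ident)
  then have "Ck k (\<lambda>x::'a. flat 0 (1 + (- (1 / R\<^sup>2)) * (x \<bullet> x)))"
    by (rule Ck_flat)
  then have bump: "Ck k (bump R :: 'a \<Rightarrow> real)"
    by (simp add: bump_def[abs_def])
  show "Ck k (\<lambda>x::'a. (b * bump R x) *\<^sub>R x)"
    by (intro Ck_bilinear[OF bounded_bilinear_scaleR] Ck_bilinear[OF bounded_bilinear_mult] Ck_const bump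
        Ck_bounded_linear bounded_linear_ident)
qed

lemma bump_bounds: "0 \<le> bump R x" "bump R x \<le> 1"
  by (auto simp: bump_def flat_def)

lemma bump_zero:
  assumes "0 < R" and "R < norm x"
  shows "bump R x = 0"
proof -
  have "R\<^sup>2 < (norm x)\<^sup>2" using assms by (intro power_strict_mono) auto
  then show ?thesis using assms by (simp add: bump_def flat_def dot_square_norm)
qed

lemma bump_ge:
  assumes "0 < R" and "2 * (x \<bullet> x) \<le> R\<^sup>2"
  shows "exp (- 2) \<le> bump R x"
proof -
  define y where "y = 1 - (x \<bullet> x) / R\<^sup>2"
  have y: "1 / 2 \<le> y" using assms by (simp add: y_def divide_le_eq)
  then have "1 / y \<le> 1 / (1 / 2)" by (intro divide_left_mono) auto
  then show ?thesis using y by (simp add: bump_def flat_def flip: y_def)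
qed

lemma continuous_bump: "continuous_on UNIV (bump R :: 'a::euclidean_space \<Rightarrow> real)"
proof -
  have "continuous_on UNIV (flat 0)"
    using flat_has_derivative by (meson DERIV_isCont continuous_at_imp_continuous_on)
  then show ?thesis
    unfolding bump_def divide_inverse by (rule continuous_on_compose2) (auto intro!: continuous_intros)
qed

lemma integral_lborel_supported:
  fixes f :: "'a::euclidean_space \<Rightarrow> real"
  assumes "continuous_on UNIV f" and "\<And>x. x \<notin> cbox a b \<Longrightarrow> f x = 0"
  shows "(\<integral>x. f x \<partial>lborel) = integral (cbox a b) f"
proof -
  have "set_integrable lborel (cbox a b) f"
    unfolding set_integrable_def
    by (intro borel_integrable_compact continuous_on_subset[OF assms(1)]) auto
  then have "(LINT x:cbox a b|lborel. f x) = integral (cbox a b) f"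
    by (rule set_borel_integral_eq_integral)
  moreover have "(\<lambda>x. indicator (cbox a b) x *\<^sub>R f x) = f"
    using assms(2) by (auto simp: indicator_def fun_eq_iff)
  ultimately show ?thesis by (simp add: set_lebesgue_integral_def)
qed

definition cube :: "real \<Rightarrow> (real^3) set" where
  "cube s = cbox (\<chi> i. - s) (\<chi> i. s)"

lemma mem_cube: "x \<in> cube s \<longleftrightarrow> (\<forall>i. \<bar>x $ i\<bar> \<le> s)"
  by (auto simp: cube_def mem_box_cart abs_le_iff) (metis minus_le_iff)+

lemma norm_le_mem_cube: "norm x \<le> s \<Longrightarrow> x \<in> cube s"
  unfolding mem_cube using component_le_norm_cart order_trans by blast

lemma measure_cube: "0 \<le> s \<Longrightarrow> measure lborel (cube s) = 8 * s ^ 3"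
  unfolding cube_def by (subst content_cbox_cart) (auto simp: interval_eq_empty_cart power3_eq_cube)

lemma inner_le_cube:
  assumes "x \<in> cube s"
  shows "x \<bullet> x \<le> 3 * s\<^sup>2"
proof -
  have "x $ i * x $ i \<le> s\<^sup>2" for i
    using assms power_mono[of "\<bar>x $ i\<bar>" s 2] by (simp add: mem_cube power2_eq_square)
  then have "(\<Sum>i\<in>UNIV. x $ i * x $ i) \<le> (\<Sum>i\<in>(UNIV :: 3 set). s\<^sup>2)"
    by (rule sum_mono)
  then show ?thesis by (simp add: inner_vec_def)
qed

lemma bump_moment_ge:
  assumes "0 < R" and "R \<le> s"
  shows "exp (- 2) * 3 / 8192 * R ^ 5 \<le> integral (cube s) (\<lambda>x. bump R x * (x \<bullet> x))"
proof -
  let ?C = "cbox (\<chi> i. R / 4) (\<chi> i. 3 * R / 8) :: (real^3) set"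
  have C: "R / 4 \<le> x $ i" "x $ i \<le> 3 * R / 8" if "x \<in> ?C" for x i
    using that by (auto simp: mem_box_cart)
  have sub: "?C \<subseteq> cube s"
  proof
    fix x assume x: "x \<in> ?C"
    have "\<bar>x $ i\<bar> \<le> s" for i
      using C[OF x, of i] assms by linarith
    then show "x \<in> cube s" by (simp add: mem_cube)
  qed
  have cont: "continuous_on S (\<lambda>x::real^3. bump R x * (x \<bullet> x))" for S
    by (intro continuous_intros continuous_on_subset[OF continuous_bump]) auto
  have lower: "exp (- 2) * (3 / 16 * R\<^sup>2) \<le> bump R x * (x \<bullet> x)" if x: "x \<in> ?C" for x
  proof -
    have "(R / 4)\<^sup>2 \<le> x $ i * x $ i" "x $ i * x $ i \<le> (3 * R / 8)\<^sup>2" for i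
      using C[OF x, of i] assms power_mono[of "R / 4" "x $ i" 2] power_mono[of "x $ i" "3 * R / 8" 2]
      by (simp_all only: power2_eq_square)
    then have "(\<Sum>i\<in>(UNIV :: 3 set). (R / 4)\<^sup>2) \<le> (\<Sum>i\<in>UNIV. x $ i * x $ i)"
      "(\<Sum>i\<in>UNIV. x $ i * x $ i) \<le> (\<Sum>i\<in>(UNIV :: 3 set). (3 * R / 8)\<^sup>2)"
      by (blast intro: sum_mono)+
    then have "3 / 16 * R\<^sup>2 \<le> x \<bullet> x" "x \<bullet> x \<le> 27 / 64 * R\<^sup>2"
      by (simp_all add: inner_vec_def power2_eq_square)
    moreover from this have "exp (- 2) \<le> bump R x"
      using assms by (intro bump_ge) auto
    ultimately show ?thesis by (intro mult_mono) (auto simp: bump_bounds)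
  qed
  have "measure lborel ?C = (R / 8) ^ 3"
    using assms by (subst content_cbox_cart) (auto simp: interval_eq_empty_cart power3_eq_cube)
  then have "exp (- 2) * 3 / 8192 * R ^ 5 = integral ?C (\<lambda>x. exp (- 2) * (3 / 16 * R\<^sup>2))"
    by (simp add: power_divide eval_nat_numeral)
  also have "\<dots> \<le> integral ?C (\<lambda>x. bump R x * (x \<bullet> x))"
    by (intro integral_le lower integrable_continuous cont) auto
  also have "\<dots> \<le> integral (cube s) (\<lambda>x. bump R x * (x \<bullet> x))"
    by (rule integral_subset_le[OF sub])
      (auto intro!: integrable_continuous cont mult_nonneg_nonneg bump_bounds simp: cube_def)
  finally show ?thesis .
qed

section \<open>Finite life span\<close>

lemma riccati_lifespan:
  fixes z z' :: "real \<Rightarrow> real"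
  assumes "0 < T" "0 < K" "0 < z 0"
    and der: "\<And>t. t \<in> {0..T} \<Longrightarrow> (z has_real_derivative z' t) (at t within {0..T})"
    and nonneg: "\<And>t. t \<in> {0..T} \<Longrightarrow> 0 \<le> z' t"
    and growth: "\<And>t. t \<in> {0..T} \<Longrightarrow> 0 < z t \<Longrightarrow> (z t)\<^sup>2 \<le> K * z' t"
  shows "T * z 0 < K"
proof -
  have pos: "0 < z t" if "t \<in> {0..T}" for t
  proof -
    have "\<exists>s\<in>{0..t}. z t - z 0 = z' s * (t - 0)"
    proof (rule mvt_very_simple)
      fix s assume "0 \<le> s" "s \<le> t"
      then show "(z has_derivative (*) (z' s)) (at s within {0..t})"
        using der[of s] that has_derivative_subset[of z _ s "{0..T}" "{0..t}"]
        by (auto simp: has_field_derivative_def)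
    qed (use that in auto)
    then obtain s where s: "s \<in> {0..t}" and eq: "z t - z 0 = z' s * (t - 0)" by blast
    have "0 \<le> z' s * (t - 0)" using nonneg[of s] s that by (intro mult_nonneg_nonneg) auto
    then show ?thesis using eq assms(3) by simp
  qed
  have "\<exists>s\<in>{0..T}. (T / K + inverse (z T)) - (0 / K + inverse (z 0))
      = (1 / K - z' s * (inverse (z s) * inverse (z s))) * (T - 0)"
  proof (rule mvt_very_simple)
    fix s assume "0 \<le> s" "s \<le> T"
    then have s: "s \<in> {0..T}" by simp
    have "((\<lambda>t. t / K + inverse (z t)) has_field_derivative
        1 / K + - (inverse (z s) * z' s * inverse (z s))) (at s within {0..T})"
      using pos[OF s] by (intro DERIV_add DERIV_inverse' der s DERIV_cdivide DERIV_ident) auto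
    then show "((\<lambda>t. t / K + inverse (z t)) has_derivative
        (*) (1 / K - z' s * (inverse (z s) * inverse (z s)))) (at s within {0..T})"
      by (simp add: has_field_derivative_def ac_simps)
  qed (use assms in simp)
  then obtain s where s: "s \<in> {0..T}" and eq: "(T / K + inverse (z T)) - inverse (z 0)
      = (1 / K - z' s * (inverse (z s) * inverse (z s))) * T" by auto
  have "1 / K \<le> z' s * (inverse (z s) * inverse (z s))"
    using growth[OF s pos[OF s]] pos[OF s] assms(2) by (simp add: field_simps power2_eq_square)
  then have "(1 / K - z' s * (inverse (z s) * inverse (z s))) * T \<le> 0"
    using assms(1) by (intro mult_nonpos_nonneg) auto
  then have "T / K + inverse (z T) \<le> inverse (z 0)" using eq by linarith
  moreover have "0 < inverse (z T)" using pos[of T] assms(1) by simp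
  ultimately have "T / K < inverse (z 0)" by linarith
  then show ?thesis using assms by (simp add: field_simps)
qed

lemma powr_tangent_ge:
  fixes r \<gamma> :: real
  assumes "0 < r" and "1 < \<gamma>"
  shows "1 + \<gamma> * (r - 1) \<le> r powr \<gamma>"
proof -
  have "(r powr \<gamma>) powr (1 / \<gamma>) * 1 powr (1 - 1 / \<gamma>) \<le> 1 / \<gamma> * r powr \<gamma> + (1 - 1 / \<gamma>) * 1"
    using assms by (intro Youngs_inequality_0) auto
  then have "r \<le> 1 / \<gamma> * r powr \<gamma> + (1 - 1 / \<gamma>)"
    using assms by (simp add: powr_powr)
  then have "\<gamma> * r \<le> \<gamma> * (1 / \<gamma> * r powr \<gamma> + (1 - 1 / \<gamma>))"
    using assms by (intro mult_left_mono) auto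
  also have "\<dots> = r powr \<gamma> + \<gamma> - 1"
    using assms by (simp add: field_simps)
  finally show ?thesis by (simp add: algebra_simps)
qed

lemma entropy_ge:
  assumes "0 < r" "1 < \<gamma>" "0 < a" "0 \<le> G"
  shows "entropy a \<gamma> G 1 + (2 * a / (\<gamma> - 1) * \<gamma> + 2 * G) * (r - 1) \<le> r * entropy a \<gamma> G r"
proof -
  have "r * entropy a \<gamma> G r = 2 * a / (\<gamma> - 1) * (r * r powr (\<gamma> - 1)) + 2 * a + 2 * G * (r * ln r)"
    using assms by (simp add: entropy_def algebra_simps)
  also have "r * r powr (\<gamma> - 1) = r powr \<gamma>"
    using assms by (simp add: powr_mult_base)
  finally have eq: "r * entropy a \<gamma> G r = 2 * a / (\<gamma> - 1) * r powr \<gamma> + 2 * a + 2 * G * (r * ln r)" .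
  have "2 * a / (\<gamma> - 1) * (1 + \<gamma> * (r - 1)) \<le> 2 * a / (\<gamma> - 1) * r powr \<gamma>"
    using assms by (intro mult_left_mono powr_tangent_ge) auto
  moreover have "r - 1 \<le> r * ln r"
    using ln_le_minus_one[of "1 / r"] assms by (simp add: ln_div field_simps)
  then have "2 * G * (r - 1) \<le> 2 * G * (r * ln r)"
    using assms by (intro mult_left_mono) auto
  ultimately show ?thesis unfolding eq by (simp add: entropy_def ring_distribs)
qed

lemma C1_material_continuous:
  assumes "C1_material J u f Df" and "t \<in> J"
  shows "continuous_on S (f t)"
  using assms C1_derivs_slice by (auto simp: C1_material_def)

lemma (in viscoelastic_flow) lifespan_bound:
  fixes T d r k :: real and \<alpha> \<beta> :: "real^3"
  defines "V \<equiv> measure lborel (cbox \<alpha> \<beta>)"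
  assumes JT: "J = {0..T}" "0 < T"
    and bg: "\<And>t. t \<in> J \<Longrightarrow> background_outside r (\<rho> t) (u t) (A t) (F t)"
    and box: "0 < d" "cball 0 (r + d) \<subseteq> cbox \<alpha> \<beta>"
    and \<rho>0: "\<And>x. \<rho> 0 x = 1"
    and k: "\<And>x. x \<in> cbox \<alpha> \<beta> \<Longrightarrow> x \<bullet> x \<le> k" "0 < k * V"
    and init: "0 < integral (cbox \<alpha> \<beta>) (virial 0) + lam * (V * entropy a \<gamma> (\<mu>\<^sub>0 / lam) 1)"
  shows "T * (integral (cbox \<alpha> \<beta>) (virial 0) + lam * (V * entropy a \<gamma> (\<mu>\<^sub>0 / lam) 1)) < k * V"
proof -
  let ?B = "cbox \<alpha> \<beta>" and ?G = "\<mu>\<^sub>0 / lam"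
  obtain \<rho>t \<rho>x ut ux St Sx Dv where \<rho>: "C1_derivs J \<rho> \<rho>t \<rho>x" and u: "C1_derivs J u ut ux"
    and S: "C1_derivs J total_stress St Sx" and v: "C1_material J u virial Dv"
    and mass: "\<And>t x. t \<in> J \<Longrightarrow> \<rho>t t x + (\<Sum>j\<in>UNIV. \<rho> t x * ux j t x $ j + \<rho>x j t x * u t x $ j) = 0"
    and Dv: "\<And>t x. t \<in> J \<Longrightarrow> \<rho> t x * Dv t x = \<rho> t x * (u t x \<bullet> u t x) + 3 * (pressure a \<gamma> (\<rho> t x) - a)
       + (\<Sum>i\<in>UNIV. \<Sum>j\<in>UNIV. (x - (2 * lam) *\<^sub>R u t x) $ i * Sx j t x $ i $ j
            + (axis j 1 - (2 * lam) *\<^sub>R ux j t x) $ i * total_stress t x $ i $ j)"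
    by (rule virial_identity) (rule that)
  have u0: "u t x = 0" and S0: "total_stress t x = 0" if "t \<in> J" "r < norm x" for t x
    using bg[OF that(1)] that(2)
    by (auto simp: background_outside_def total_stress_def stress_def pressure_def)
  have transport: "((\<lambda>t. integral ?B (\<lambda>x. \<rho> t x * f t x)) has_real_derivative
      integral ?B (\<lambda>x. \<rho> t x * Df t x)) (at t within J)" if "C1_material J u f Df" "t \<in> J" for f Df t
    by (rule transport_theorem[OF \<rho> u that(1) _ _ box J(1) that(2)]) (rule mass u0; assumption)+
  have c\<rho>: "continuous_on D (\<rho> t)" and cu: "continuous_on D (u t)" and cv: "continuous_on D (virial t)"
    if "t \<in> J" for t D
    using C1_derivs_slice[OF \<rho> that] C1_derivs_slice[OF u that]
      C1_material_continuous[OF v that] by auto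
  have cp: "continuous_on D (\<lambda>x. pressure a \<gamma> (\<rho> t x))" if "t \<in> J" for t D
    unfolding pressure_def using pos[OF that] by (auto intro!: continuous_intros c\<rho>[OF that] simp: less_imp_neq[symmetric])
  note cont = c\<rho> cu cv cp

  have "((\<lambda>t. integral ?B (\<lambda>x. \<rho> t x * 1)) has_real_derivative integral ?B (\<lambda>x. \<rho> t x * 0)) (at t within J)"
    if "t \<in> J" for t
    by (rule transport[OF C1_material_const that])
  then have "\<exists>c. \<forall>t\<in>J. integral ?B (\<rho> t) = c"
    by (intro has_field_derivative_zero_constant J(1)) simp
  moreover have "integral ?B (\<rho> 0) = V" by (simp add: ext[of "\<rho> 0" "\<lambda>x. 1", OF \<rho>0] V_def)
  ultimately have M: "integral ?B (\<rho> t) = V" if "t \<in> J" for t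
    using that JT by (metis atLeastAtMost_iff less_eq_real_def)
  have M1: "integral ?B (\<lambda>x. \<rho> t x - 1) = 0" if "t \<in> J" for t
    using M[OF that] by (subst integral_diff) (auto intro!: integrable_continuous cont that simp: V_def)

  define z where "z t = integral ?B (\<lambda>x. \<rho> t x * virial t x) + lam * (V * entropy a \<gamma> ?G 1)" for t
  define E where "E t = integral ?B (\<lambda>x. \<rho> t x * (u t x \<bullet> u t x))" for t
  define W where "W t = integral ?B (\<lambda>x. \<rho> t x * (x \<bullet> u t x))" for t
  have z_der: "(z has_real_derivative integral ?B (\<lambda>x. \<rho> t x * Dv t x)) (at t within J)" if "t \<in> J" for t
    unfolding z_def[abs_def] using DERIV_add[OF transport[OF v that] DERIV_const] by simp
  have E_le: "E t \<le> integral ?B (\<lambda>x. \<rho> t x * Dv t x)" if t: "t \<in> J" for t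
  proof -
    let ?div = "\<lambda>x. \<Sum>i\<in>UNIV. \<Sum>j\<in>UNIV. (x - (2 * lam) *\<^sub>R u t x) $ i * Sx j t x $ i $ j
            + (axis j 1 - (2 * lam) *\<^sub>R ux j t x) $ i * total_stress t x $ i $ j"
    have "C1_derivs J (\<lambda>t x. x + (- (2 * lam)) *\<^sub>R u t x) (\<lambda>t x. 0 + (- (2 * lam)) *\<^sub>R ut t x)
        (\<lambda>j t x. axis j 1 + (- (2 * lam)) *\<^sub>R ux j t x)"
      by (rule C1_derivs_add[OF C1_derivs_position C1_derivs_linear[OF bounded_linear_scaleR_right u]])
    from integral_div_zero[OF this S S0(1)[OF t] box t]
    have div: "(?div has_integral 0) ?B" by simp
    have "E t = integral ?B (\<lambda>x. \<rho> t x * (u t x \<bullet> u t x)) + 3 * a * \<gamma> * integral ?B (\<lambda>x. \<rho> t x - 1)"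
      by (simp add: E_def M1[OF t])
    also have "\<dots> = integral ?B (\<lambda>x. \<rho> t x * (u t x \<bullet> u t x) + 3 * a * \<gamma> * (\<rho> t x - 1))"
      by (subst integral_add) (auto intro!: integrable_continuous continuous_intros cont t)
    also have "\<dots> \<le> integral ?B (\<lambda>x. \<rho> t x * (u t x \<bullet> u t x) + 3 * (pressure a \<gamma> (\<rho> t x) - a))"
    proof (rule integral_le)
      fix x
      have "a * (1 + \<gamma> * (\<rho> t x - 1)) \<le> a * \<rho> t x powr \<gamma>"
        using a \<gamma> pos[OF t] by (intro mult_left_mono powr_tangent_ge) auto
      then show "\<rho> t x * (u t x \<bullet> u t x) + 3 * a * \<gamma> * (\<rho> t x - 1)
          \<le> \<rho> t x * (u t x \<bullet> u t x) + 3 * (pressure a \<gamma> (\<rho> t x) - a)"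
        by (simp add: pressure_def algebra_simps)
    qed (auto intro!: integrable_continuous continuous_intros cont t)
    also have "\<dots> = integral ?B (\<lambda>x. \<rho> t x * (u t x \<bullet> u t x) + 3 * (pressure a \<gamma> (\<rho> t x) - a)) + integral ?B ?div"
      using div by (simp add: integral_unique)
    also have "\<dots> = integral ?B (\<lambda>x. \<rho> t x * Dv t x)"
      unfolding Dv[OF t]
      by (intro integral_add[symmetric] has_integral_integrable[OF div] integrable_continuous continuous_intros cont t)
    finally show ?thesis .
  qed
  have E_nonneg: "0 \<le> E t" if "t \<in> J" for t
    unfolding E_def using pos[OF that]
    by (intro integral_nonneg integrable_continuous continuous_intros cont that) (simp add: less_imp_le)
  have z_le: "z t \<le> W t" if t: "t \<in> J" for t
  proof -
    let ?c = "2 * a / (\<gamma> - 1) * \<gamma> + 2 * ?G"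
    have "integral ?B (\<lambda>x. \<rho> t x * virial t x)
        \<le> integral ?B (\<lambda>x. \<rho> t x * (x \<bullet> u t x) - lam * (entropy a \<gamma> ?G 1 + ?c * (\<rho> t x - 1)))"
    proof (rule integral_le)
      fix x
      have "0 \<le> \<rho> t x * (u t x \<bullet> u t x + ?G * trace (conf t x))"
        using pos[OF t, of x] lam \<mu> trace_conjugation_nonneg[OF spd[OF t]] by (auto simp: conf_def)
      moreover have "entropy a \<gamma> ?G 1 + ?c * (\<rho> t x - 1) \<le> \<rho> t x * entropy a \<gamma> ?G (\<rho> t x)"
        using pos[OF t] \<gamma> a lam \<mu> by (intro entropy_ge) auto
      ultimately have "entropy a \<gamma> ?G 1 + ?c * (\<rho> t x - 1)
          \<le> \<rho> t x * (u t x \<bullet> u t x + ?G * trace (conf t x) + entropy a \<gamma> ?G (\<rho> t x))"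
        by (simp add: distrib_left)
      then have "lam * (entropy a \<gamma> ?G 1 + ?c * (\<rho> t x - 1))
          \<le> lam * (\<rho> t x * (u t x \<bullet> u t x + ?G * trace (conf t x) + entropy a \<gamma> ?G (\<rho> t x)))"
        using lam by (intro mult_left_mono) auto
      moreover have "\<rho> t x * virial t x = \<rho> t x * (x \<bullet> u t x)
          - lam * (\<rho> t x * (u t x \<bullet> u t x + ?G * trace (conf t x) + entropy a \<gamma> ?G (\<rho> t x)))"
        by (simp only: virial_def right_diff_distrib mult.left_commute)
      ultimately show "\<rho> t x * virial t x
          \<le> \<rho> t x * (x \<bullet> u t x) - lam * (entropy a \<gamma> ?G 1 + ?c * (\<rho> t x - 1))" by linarith
    qed (intro integrable_continuous continuous_intros cont t)+
    also have "\<dots> = W t - lam * (V * entropy a \<gamma> ?G 1 + ?c * integral ?B (\<lambda>x. \<rho> t x - 1))"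
    proof -
      have i: "(\<lambda>x. \<rho> t x - 1) integrable_on ?B" "(\<lambda>x. \<rho> t x * (x \<bullet> u t x)) integrable_on ?B"
        by (intro integrable_continuous continuous_intros cont t)+
      have "((\<lambda>x. \<rho> t x * (x \<bullet> u t x) - lam * (entropy a \<gamma> ?G 1 + ?c * (\<rho> t x - 1))) has_integral
          W t - lam * (V * entropy a \<gamma> ?G 1 + ?c * integral ?B (\<lambda>x. \<rho> t x - 1))) ?B"
        unfolding W_def
        by (intro has_integral_diff has_integral_mult_right has_integral_add integrable_integral i)
          (use has_integral_const[of "entropy a \<gamma> ?G 1" \<alpha> \<beta>] in \<open>simp add: V_def\<close>)
      then show ?thesis by (rule integral_unique)
    qed
    finally show ?thesis by (simp add: z_def M1[OF t])
  qed
  have W_le: "(W t)\<^sup>2 \<le> k * V * E t" if t: "t \<in> J" for t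
  proof -
    define c where "c = W t / (k * V)"
    have "integral ?B (\<lambda>x. 2 * c * (\<rho> t x * (x \<bullet> u t x)) - c\<^sup>2 * k * \<rho> t x) \<le> E t"
      unfolding E_def
    proof (rule integral_le)
      fix x assume x: "x \<in> ?B"
      have "0 \<le> (u t x - c *\<^sub>R x) \<bullet> (u t x - c *\<^sub>R x)" by simp
      also have "\<dots> = u t x \<bullet> u t x - 2 * c * (x \<bullet> u t x) + c\<^sup>2 * (x \<bullet> x)"
        by (simp add: inner_diff_left inner_diff_right inner_commute power2_eq_square algebra_simps)
      also have "\<dots> \<le> u t x \<bullet> u t x - 2 * c * (x \<bullet> u t x) + c\<^sup>2 * k"
        using k(1)[OF x] by (simp add: mult_left_mono)
      finally have "0 \<le> \<rho> t x * (u t x \<bullet> u t x - 2 * c * (x \<bullet> u t x) + c\<^sup>2 * k)"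
        using pos[OF t, of x] by simp
      then show "2 * c * (\<rho> t x * (x \<bullet> u t x)) - c\<^sup>2 * k * \<rho> t x \<le> \<rho> t x * (u t x \<bullet> u t x)"
        by (simp add: algebra_simps)
    qed (intro integrable_continuous continuous_intros cont t)+
    moreover have "integral ?B (\<lambda>x. 2 * c * (\<rho> t x * (x \<bullet> u t x)) - c\<^sup>2 * k * \<rho> t x) = 2 * c * W t - c\<^sup>2 * k * V"
      unfolding W_def M[OF t, symmetric]
      by (intro integral_unique has_integral_diff has_integral_mult_right integrable_integral
          integrable_continuous continuous_intros cont t)
    ultimately have "2 * c * W t - c\<^sup>2 * (k * V) \<le> E t" by (simp add: algebra_simps)
    moreover have "W t = c * (k * V)" using less_imp_neq[OF k(2)] by (simp add: c_def)
    ultimately have "c\<^sup>2 * (k * V) \<le> E t" by (simp add: power2_eq_square algebra_simps)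
    then have "(k * V) * (c\<^sup>2 * (k * V)) \<le> (k * V) * E t" using k(2) by (intro mult_left_mono) auto
    then show ?thesis using \<open>W t = c * (k * V)\<close> by (simp add: power2_eq_square algebra_simps)
  qed
  have z0: "z 0 = integral ?B (virial 0) + lam * (V * entropy a \<gamma> ?G 1)"
    by (simp add: z_def \<rho>0)
  have "T * z 0 < k * V"
  proof (rule riccati_lifespan[OF JT(2) k(2), of z])
    show "0 < z 0" using init by (simp add: z0)
    fix t assume "t \<in> {0..T}"
    then have t: "t \<in> J" using JT by simp
    show "(z has_real_derivative integral ?B (\<lambda>x. \<rho> t x * Dv t x)) (at t within {0..T})"
      using z_der[OF t] JT by simp
    show "0 \<le> integral ?B (\<lambda>x. \<rho> t x * Dv t x)"
      using E_nonneg[OF t] E_le[OF t] by linarith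
    assume "0 < z t"
    then have "(z t)\<^sup>2 \<le> (W t)\<^sup>2" using z_le[OF t] by (intro power_mono) auto
    also have "\<dots> \<le> k * V * E t" by (rule W_le[OF t])
    also have "\<dots> \<le> k * V * integral ?B (\<lambda>x. \<rho> t x * Dv t x)"
      using E_le[OF t] k(2) by (intro mult_left_mono) auto
    finally show "(z t)\<^sup>2 \<le> k * V * integral ?B (\<lambda>x. \<rho> t x * Dv t x)" .
  qed
  then show ?thesis by (simp add: z0)
qed

lemma exists_initial_velocity:
  fixes lam \<sigma> m :: real
  assumes "0 < lam" "0 < \<sigma>" "0 < m"
  obtains R and w :: "real^3 \<Rightarrow> real^3" where "0 < R" "smooth w" "\<And>x. R < norm x \<Longrightarrow> w x = 0"
    "5832 * \<sigma> * R ^ 4 + m * R ^ 3 \<le> integral (cube (3 * R)) (\<lambda>x. x \<bullet> w x)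
       - lam * integral (cube (3 * R)) (\<lambda>x. w x \<bullet> w x)"
proof -
  define c :: real where "c = exp (- 2) * 3 / 8192"
  have c: "0 < c" by (simp add: c_def)
  define U where "U = 2 * 5833 * \<sigma> / c"
  have U: "0 < U" using assms c by (simp add: U_def)
  define R where "R = max (2 * lam * U) (m / \<sigma>)"
  have R: "0 < R" "2 * lam * U \<le> R" "m / \<sigma> \<le> R"
    using assms U by (auto simp: R_def less_max_iff_disj)
  define b where "b = U / R"
  have b: "0 < b" "lam * b \<le> 1 / 2" using R U by (auto simp: b_def field_simps)
  define w where "w x = (b * bump R x) *\<^sub>R x" for x :: "real^3"
  let ?B = "cube (3 * R)"
  define M where "M = integral ?B (\<lambda>x. bump R x * (x \<bullet> x))"
  have M: "c * R ^ 5 \<le> M"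
    unfolding M_def c_def by (rule bump_moment_ge) (use R in auto)
  have cont: "continuous_on S (bump R)" for S :: "(real^3) set"
    using continuous_bump continuous_on_subset by blast
  have int: "f integrable_on ?B" if "continuous_on (cube (3 * R)) f" for f :: "real^3 \<Rightarrow> real"
    unfolding cube_def by (rule integrable_continuous) (use that in \<open>simp add: cube_def\<close>)
  have "integral ?B (\<lambda>x. x \<bullet> w x) = b * M"
    unfolding M_def by (simp add: w_def mult.assoc)
  moreover have "integral ?B (\<lambda>x. w x \<bullet> w x) \<le> b\<^sup>2 * M"
  proof -
    have "integral ?B (\<lambda>x. w x \<bullet> w x) \<le> integral ?B (\<lambda>x. b\<^sup>2 * (bump R x * (x \<bullet> x)))"
    proof (rule integral_le)
      fix x :: "real^3"
      have "bump R x * (bump R x * (x \<bullet> x)) \<le> bump R x * (x \<bullet> x)"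
        by (intro mult_left_le_one_le mult_nonneg_nonneg bump_bounds) auto
      then have "b\<^sup>2 * (bump R x * (bump R x * (x \<bullet> x))) \<le> b\<^sup>2 * (bump R x * (x \<bullet> x))"
        by (rule mult_left_mono) simp
      then show "w x \<bullet> w x \<le> b\<^sup>2 * (bump R x * (x \<bullet> x))"
        by (simp add: w_def power2_eq_square algebra_simps)
    qed (auto intro!: int continuous_intros cont simp: w_def)
    then show ?thesis by (simp add: M_def)
  qed
  then have "lam * integral ?B (\<lambda>x. w x \<bullet> w x) \<le> lam * (b\<^sup>2 * M)"
    using assms by (intro mult_left_mono) auto
  moreover have "5832 * \<sigma> * R ^ 4 + m * R ^ 3 \<le> b * M - lam * (b\<^sup>2 * M)"
  proof -
    have "m * R ^ 3 \<le> \<sigma> * R ^ 4"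
      using mult_right_mono[OF R(3), of "\<sigma> * R ^ 3"] assms R(1) by (simp add: eval_nat_numeral ac_simps)
    then have "5832 * \<sigma> * R ^ 4 + m * R ^ 3 \<le> 5833 * \<sigma> * R ^ 4" by simp
    also have "\<dots> = b * (c * R ^ 5) * (1 / 2)"
      using R(1) c by (simp add: b_def U_def eval_nat_numeral)
    also have "\<dots> \<le> b * M * (1 - lam * b)"
      using b M c R(1) by (intro mult_mono mult_left_mono mult_nonneg_nonneg order_trans[OF _ M]) auto
    finally show ?thesis by (simp add: power2_eq_square algebra_simps)
  qed
  ultimately have "5832 * \<sigma> * R ^ 4 + m * R ^ 3 \<le> integral ?B (\<lambda>x. x \<bullet> w x) - lam * integral ?B (\<lambda>x. w x \<bullet> w x)"
    by linarith
  moreover have "smooth w"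
    unfolding w_def[abs_def] by (rule smooth_bump_field)
  moreover have "w x = 0" if "R < norm x" for x
    using bump_zero[OF R(1) that] by (simp add: w_def)
  ultimately show thesis using that R(1) by blast
qed

lemma C1_on_subset: "C1_on S f \<Longrightarrow> S' \<subseteq> S \<Longrightarrow> C1_on S' f"
  unfolding C1_on_def by (meson continuous_on_subset has_derivative_subset subsetD)

lemma C1_on_vector_derivative_subset:
  fixes f :: "real \<Rightarrow> real^'n \<Rightarrow> 'b::real_normed_vector"
  assumes "C1_on (I \<times> UNIV) (\<lambda>(t, x). f t x)" "J \<subseteq> I" "t \<in> J" "at t within J \<noteq> bot"
  shows "vector_derivative (\<lambda>s. f s x) (at t within J) = vector_derivative (\<lambda>s. f s x) (at t within I)"
proof -
  obtain ft fx where f: "C1_derivs I f ft fx" using assms(1) by (rule C1_derivs_exists)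
  have "((\<lambda>s. f s x) has_vector_derivative ft t x) (at t within I)"
    by (rule C1_derivs_time[OF f]) (use assms in auto)
  moreover from this have "((\<lambda>s. f s x) has_vector_derivative ft t x) (at t within J)"
    using assms(2) by (rule has_vector_derivative_within_subset)
  moreover have "at t within I \<noteq> bot"
    using at_le[OF assms(2), of t] assms(4) by (auto simp: bot_unique)
  ultimately show ?thesis using assms(4) by (simp add: vector_derivative_within)
qed

lemma C1_solution_subset:
  assumes sol: "C1_solution lam \<mu>\<^sub>0 a \<gamma> I \<rho> u A F" and J: "J \<subseteq> I" "\<And>t. t \<in> J \<Longrightarrow> at t within J \<noteq> bot"
  shows "C1_solution lam \<mu>\<^sub>0 a \<gamma> J \<rho> u A F"
proof -
  have C1: "C1_on (I \<times> UNIV) (\<lambda>(t, x). \<rho> t x)" "C1_on (I \<times> UNIV) (\<lambda>(t, x). u t x)"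
    "C1_on (I \<times> UNIV) (\<lambda>(t, x). A t x)" "C1_on (I \<times> UNIV) (\<lambda>(t, x). F t x)"
    using sol by (auto simp: C1_solution_def)
  have sub: "J \<times> UNIV \<subseteq> I \<times> (UNIV :: (real^3) set)" using J by auto
  note vd = C1(1)[THEN C1_on_vector_derivative_subset, OF J(1) _ J(2)]
    C1(2)[THEN C1_on_vector_derivative_subset, OF J(1) _ J(2)]
    C1(3)[THEN C1_on_vector_derivative_subset, OF J(1) _ J(2)]
    C1(4)[THEN C1_on_vector_derivative_subset, OF J(1) _ J(2)]
  show ?thesis
    using sol C1[THEN C1_on_subset, OF sub] J(1) unfolding C1_solution_def
    by (simp add: vd subset_iff)
qed

theorem theorem2p3:
  fixes lam \<mu>\<^sub>0 a \<gamma> \<sigma> :: real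
  assumes "lam > 0" and "\<mu>\<^sub>0 > 0" and "a > 0" and "\<gamma> > 1"
    and "propagation_speed lam \<mu>\<^sub>0 a \<gamma> \<sigma>"
  shows "\<exists>R \<rho>\<^sub>0 u\<^sub>0 A\<^sub>0 F\<^sub>0.
    admissible_data lam \<mu>\<^sub>0 R \<rho>\<^sub>0 u\<^sub>0 A\<^sub>0 F\<^sub>0 \<and>
    radial_momentum \<rho>\<^sub>0 u\<^sub>0 \<ge>
      lam * (H_functional lam \<mu>\<^sub>0 a \<gamma> \<rho>\<^sub>0 A\<^sub>0 F\<^sub>0 + max_density \<rho>\<^sub>0 * (L2_norm u\<^sub>0)\<^sup>2)
      + 16 * R ^ 4 * \<sigma> * pi * max_density \<rho>\<^sub>0 / 3 \<and>
    (\<forall>(T::ereal) \<rho> u A F.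
       0 < T \<longrightarrow>
       C1_solution lam \<mu>\<^sub>0 a \<gamma> {t. 0 \<le> t \<and> ereal t < T} \<rho> u A F \<longrightarrow>
       initial_condition \<rho> u A F \<rho>\<^sub>0 u\<^sub>0 A\<^sub>0 F\<^sub>0 \<longrightarrow>
       T < \<infinity>)"
proof -
  have \<sigma>: "0 < \<sigma>" using assms(5) by (simp add: propagation_speed_def)
  obtain R w where R: "0 < R" and w: "smooth w" "\<And>x. R < norm x \<Longrightarrow> w x = 0"
    and big: "5832 * \<sigma> * R ^ 4 + 648 * \<mu>\<^sub>0 * R ^ 3 \<le> integral (cube (3 * R)) (\<lambda>x. x \<bullet> w x)
       - lam * integral (cube (3 * R)) (\<lambda>x. w x \<bullet> w x)"
    using exists_initial_velocity[of lam \<sigma> "648 * \<mu>\<^sub>0"] assms \<sigma> by auto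
  let ?B = "cube (3 * R)" and ?one = "\<lambda>x::real^3. 1::real" and ?I = "\<lambda>x::real^3. mat 1 :: real^3^3"
  have cw: "continuous_on S w" for S
    using w(1) unfolding smooth_def by (metis Ck.simps(1) continuous_on_subset subset_UNIV)
  have int: "f integrable_on ?B" if "continuous_on (cube (3 * R)) f" for f :: "real^3 \<Rightarrow> real"
    unfolding cube_def by (rule integrable_continuous) (use that in \<open>simp add: cube_def\<close>)
  have supp: "w x = 0" if "x \<notin> ?B" for x
    using norm_le_mem_cube[of x "3 * R"] that R by (intro w(2)) force
  have spd: "sym_pos_def (mat 1)"
    by (simp add: sym_pos_def_def)
  have inv: "invertible (mat 1 :: real^3^3)"
    unfolding invertible_def by (rule exI[of _ "mat 1"]) simp
  have adm: "admissible_data lam \<mu>\<^sub>0 R ?one w ?I ?I"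
    using w R spd inv
    by (auto simp: admissible_data_def smooth_data_def background_outside_def stress_def
        trace_def smooth_def Ck_const)
  have rm: "radial_momentum ?one w = integral ?B (\<lambda>x. x \<bullet> w x)"
    using supp cw unfolding radial_momentum_def cube_def scaleR_one
    by (intro integral_lborel_supported) (auto intro!: continuous_intros)
  have L2: "(L2_norm w)\<^sup>2 = integral ?B (\<lambda>x. w x \<bullet> w x)"
  proof -
    have "(L2_norm w)\<^sup>2 = (\<integral>x. w x \<bullet> w x \<partial>lborel)"
      unfolding L2_norm_def dot_square_norm by (intro real_sqrt_pow2 integral_nonneg_AE) simp
    also have "\<dots> = integral ?B (\<lambda>x. w x \<bullet> w x)"
      using supp cw unfolding cube_def
      by (intro integral_lborel_supported) (auto intro!: continuous_intros)
    finally show ?thesis .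
  qed
  have H: "H_functional lam \<mu>\<^sub>0 a \<gamma> ?one ?I ?I = 0"
    by (simp add: H_functional_def stress_def trace_def)
  have md: "max_density ?one = 1"
    by (simp add: max_density_def)
  have "16 * R ^ 4 * \<sigma> * pi / 3 \<le> 16 * R ^ 4 * \<sigma> * 4 / 3"
    using R \<sigma> pi_less_4 by (intro divide_right_mono mult_left_mono) auto
  also have "\<dots> \<le> 5832 * \<sigma> * R ^ 4 + 648 * \<mu>\<^sub>0 * R ^ 3"
  proof -
    have "0 \<le> \<sigma> * R ^ 4" "0 \<le> \<mu>\<^sub>0 * R ^ 3" using R \<sigma> assms by auto
    then show ?thesis by simp
  qed
  finally have cond: "radial_momentum ?one w \<ge>
      lam * (H_functional lam \<mu>\<^sub>0 a \<gamma> ?one ?I ?I + max_density ?one * (L2_norm w)\<^sup>2)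
      + 16 * R ^ 4 * \<sigma> * pi * max_density ?one / 3"
    using big by (simp add: rm L2 H md)
  have False
    if sol: "C1_solution lam \<mu>\<^sub>0 a \<gamma> {0..} \<rho> u A F" and init: "initial_condition \<rho> u A F ?one w ?I ?I"
    for \<rho> u A F
  proof -
    define T where "T = R / \<sigma>"
    have T: "0 < T" using R \<sigma> by (simp add: T_def)
    have nbot: "at t within {0..T} \<noteq> bot" if "t \<in> {0..T}" for t
      using that T by (simp add: trivial_limit_within)
    have solT: "C1_solution lam \<mu>\<^sub>0 a \<gamma> {0..T} \<rho> u A F"
      by (rule C1_solution_subset[OF sol _ nbot]) auto
    interpret viscoelastic_flow lam \<mu>\<^sub>0 a \<gamma> "{0..T}" \<rho> u A F
      by unfold_locales (use assms solT nbot in auto)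
    have bg: "background_outside (2 * R) (\<rho> t) (u t) (A t) (F t)" if t: "t \<in> {0..T}" for t
    proof -
      have "background_outside (R + \<sigma> * t) (\<rho> t) (u t) (A t) (F t)"
        using assms(5) adm T solT init t unfolding propagation_speed_def by blast
      moreover have "R + \<sigma> * t \<le> 2 * R" using t \<sigma> by (simp add: T_def field_simps)
      ultimately show ?thesis by (auto simp: background_outside_def)
    qed
    have V: "measure lborel ?B = 216 * R ^ 3"
      using R by (simp add: measure_cube power_mult_distrib)
    let ?G = "\<mu>\<^sub>0 / lam" and ?e = "entropy a \<gamma> (\<mu>\<^sub>0 / lam) 1"
    have "virial 0 = (\<lambda>x. x \<bullet> w x - lam * (w x \<bullet> w x) - lam * (3 * ?G + ?e))"
      using init by (simp add: virial_def conf_def initial_condition_def trace_I fun_eq_iff algebra_simps)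
    moreover have "((\<lambda>x. x \<bullet> w x - lam * (w x \<bullet> w x) - lam * (3 * ?G + ?e)) has_integral
       integral ?B (\<lambda>x. x \<bullet> w x) - lam * integral ?B (\<lambda>x. w x \<bullet> w x)
         - measure lborel ?B * (lam * (3 * ?G + ?e))) ?B"
      by (intro has_integral_diff has_integral_mult_right integrable_integral int continuous_intros cw)
        (use has_integral_const[of "lam * (3 * ?G + ?e)"] in \<open>simp add: cube_def\<close>)
    ultimately have v0: "integral ?B (virial 0) = integral ?B (\<lambda>x. x \<bullet> w x) - lam * integral ?B (\<lambda>x. w x \<bullet> w x)
         - measure lborel ?B * (lam * (3 * ?G + ?e))"
      by (simp add: integral_unique)
    let ?z = "integral ?B (virial 0) + lam * (measure lborel ?B * ?e)"
    have "?z = integral ?B (\<lambda>x. x \<bullet> w x) - lam * integral ?B (\<lambda>x. w x \<bullet> w x) - 648 * \<mu>\<^sub>0 * R ^ 3"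
      unfolding v0 V using assms(1) by (simp add: field_simps)
    then have z: "5832 * \<sigma> * R ^ 4 \<le> ?z" using big by simp
    let ?C = "cbox (\<chi> i. - (3 * R)) (\<chi> i. 3 * R) :: (real^3) set"
    have "T * ?z < 27 * R\<^sup>2 * measure lborel ?B"
      unfolding cube_def
    proof (rule lifespan_bound[OF refl T bg])
      show "0 < R" by (rule R)
      show "cball 0 (2 * R + R) \<subseteq> ?C"
        using norm_le_mem_cube[of _ "3 * R"] by (auto simp: cube_def)
      show "x \<bullet> x \<le> 27 * R\<^sup>2" if "x \<in> ?C" for x
        using inner_le_cube[of x "3 * R"] that by (simp add: cube_def power_mult_distrib)
      show "\<rho> 0 x = 1" for x using init by (simp add: initial_condition_def)
      show "0 < 27 * R\<^sup>2 * measure lborel (?C)"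
        using R V by (simp add: cube_def)
      have "0 < 5832 * \<sigma> * R ^ 4" using R \<sigma> by simp
      then show "0 < integral (?C) (virial 0)
         + lam * (measure lborel (?C) * ?e)"
        using z by (simp add: cube_def)
    qed auto
    moreover have "27 * R\<^sup>2 * measure lborel ?B = T * (5832 * \<sigma> * R ^ 4)"
      using \<sigma> by (simp add: V T_def eval_nat_numeral)
    moreover have "T * (5832 * \<sigma> * R ^ 4) \<le> T * ?z"
      using T z by (intro mult_left_mono) auto
    ultimately show False by linarith
  qed
  then have "T < \<infinity>"
    if "C1_solution lam \<mu>\<^sub>0 a \<gamma> {t. 0 \<le> t \<and> ereal t < T} \<rho> u A F" "initial_condition \<rho> u A F ?one w ?I ?I"
    for T :: ereal and \<rho> u A F
    using that by (cases T) (auto simp: atLeast_def)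
  with adm cond show ?thesis by blast
qed

end
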